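(* Let $\alpha\in(0,1)$, let $m, M_0>0$ be given constants, and let $\zeta_o,\zeta_b\in\mathbb{C}$ be distinct points. Let $\Omega\subseteq\mathbb{C}$ be a bounded, simply connected open set with boundary of class $C^{1,\alpha}$, with $\zeta_o\in\Omega$, $\zeta_b\in\partial\Omega$ and perimeter $L$. Assume that $B(\zeta_o,\rho)$ and $B(\zeta_o,R)$ are, respectively, the largest disk contained in $\Omega$ and the smallest disk containing $\Omega$, centered at $\zeta_o$. Let $\varphi$ be the interior normal derivative on $\partial\Omega$ (as a function of arclength) of the solution $u$ of $-\Delta u=\delta_{\zeta_o}$ in $\Omega$, $u=0$ on $\partial\Omega$, and set $C=\frac{1}{2\pi\rho}$. Then, if $\varphi\in\mathscr{G}_0^L$, there exists a constant $K$, depending on $\alpha$, $\rho$ and $M_0$, such that $$R-\rho\le K\,\Vert\varphi-C\Vert_{0,\alpha,[0,L]}.$$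
   Context: Here $\delta_{\zeta_o}$ is the Dirac delta at $\zeta_o$, so $u$ is the Green's function of the Dirichlet Laplacian in $\Omega$ with pole $\zeta_o$. Arclength $s$ on $\partial\Omega$ is measured counterclockwise starting from $\zeta_b$; $\varphi(s)$ is the derivative of $u$ in the interior normal direction at the boundary point with arclength parameter $s\in[0,L]$, regarded as an $L$-periodic function on $\mathbb{R}$. For a function $\varphi$ on an interval $I\subseteq\mathbb{R}$: $\Vert\varphi\Vert_{\infty,I}=\sup_I|\varphi|$, $[\varphi]_{0,\alpha,I}=\sup_{x,y\in I,\,x\ne y}\frac{|\varphi(x)-\varphi(y)|}{|x-y|^\alpha}$, and $\Vert\varphi\Vert_{0,\alpha,I}=\Vert\varphi\Vert_{\infty,I}+[\varphi]_{0,\alpha,I}$. $\mathscr{G}_0^L$ is the set of all $L$-periodic functions $\varphi\in C^{0,\alpha}(\mathbb{R})$ with $\varphi\ge m$ and $\Vert\varphi\Vert_{0,\alpha,[0,L]}\le M_0$.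
   Formalization: The constant K is allowed to depend on m as well as on α, ρ and M_0; independence of m fails, e.g. for a unit disk with a long smooth tube attached, where ρ and M_0 stay fixed while R grows and only m tends to 0. *)

theory Defs
  imports "HOL-Complex_Analysis.Complex_Analysis"
begin

text \<open>Hoelder norms. The suprema are taken in \<^typ>\<open>real\<close>; they are the intended ones for
  functions in the Hoelder space, where both sets are bounded above (and for nontrivial intervals,
  where both sets are nonempty).\<close>

definition difference_quotients :: "real \<Rightarrow> real set \<Rightarrow> (real \<Rightarrow> real) \<Rightarrow> real set" where
  "difference_quotients \<alpha> I f =
     {\<bar>f x - f y\<bar> / \<bar>x - y\<bar> powr \<alpha> | x y. x \<in> I \<and> y \<in> I \<and> x \<noteq> y}"

definition sup_norm_on :: "real set \<Rightarrow> (real \<Rightarrow> real) \<Rightarrow> real" where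
  "sup_norm_on I f = (SUP x\<in>I. \<bar>f x\<bar>)"

definition holder_seminorm :: "real \<Rightarrow> real set \<Rightarrow> (real \<Rightarrow> real) \<Rightarrow> real" where
  "holder_seminorm \<alpha> I f = Sup (difference_quotients \<alpha> I f)"

definition holder_norm :: "real \<Rightarrow> real set \<Rightarrow> (real \<Rightarrow> real) \<Rightarrow> real" where
  "holder_norm \<alpha> I f = sup_norm_on I f + holder_seminorm \<alpha> I f"

definition holder_space :: "real \<Rightarrow> real set \<Rightarrow> (real \<Rightarrow> real) set" where
  "holder_space \<alpha> I =
     {f. bdd_above ((\<lambda>x. \<bar>f x\<bar>) ` I) \<and> bdd_above (difference_quotients \<alpha> I f)}"

definition G0 :: "real \<Rightarrow> real \<Rightarrow> real \<Rightarrow> real \<Rightarrow> (real \<Rightarrow> real) set" where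
  "G0 \<alpha> m M0 L =
     {\<phi>. (\<forall>s. \<phi> (s + L) = \<phi> s) \<and> \<phi> \<in> holder_space \<alpha> UNIV \<and> (\<forall>s. m \<le> \<phi> s) \<and>
         holder_norm \<alpha> {0..L} \<phi> \<le> M0}"

text \<open>Boundary of class \<open>C\<^sup>1\<^sup>,\<^sup>\<alpha>\<close>: near each boundary point \<open>p\<close>, after the rigid motion
  \<open>z \<mapsto> e * (z - p)\<close> with \<open>\<bar>e\<bar> = 1\<close>, the set is the strict epigraph of a \<open>C\<^sup>1\<^sup>,\<^sup>\<alpha>\<close> function.\<close>

definition C1_alpha_boundary :: "real \<Rightarrow> complex set \<Rightarrow> bool" where
  "C1_alpha_boundary \<alpha> \<Omega> \<longleftrightarrow>
     (\<forall>p \<in> frontier \<Omega>. \<exists>r>0. \<exists>e h h'. norm e = 1 \<and>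
        (\<forall>x\<in>{-r..r}. (h has_real_derivative h' x) (at x within {-r..r})) \<and>
        h' \<in> holder_space \<alpha> {-r..r} \<and>
        (\<forall>z \<in> ball p r. z \<in> \<Omega> \<longleftrightarrow> h (Re (e * (z - p))) < Im (e * (z - p))))"

text \<open>Parametrization of the whole boundary by arclength, extended \<open>L\<close>-periodically, where \<open>L\<close>
  is the perimeter. The orientation is counterclockwise as seen from \<open>\<zeta>\<close>.\<close>

definition boundary_arclength_param ::
    "complex set \<Rightarrow> complex \<Rightarrow> real \<Rightarrow> (real \<Rightarrow> complex) \<Rightarrow> bool" where
  "boundary_arclength_param \<Omega> \<zeta> L \<gamma> \<longleftrightarrow>
     0 < L \<and> (\<forall>s. \<gamma> (s + L) = \<gamma> s) \<and>
     inj_on \<gamma> {0..<L} \<and> \<gamma> ` {0..<L} = frontier \<Omega> \<and>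
     (\<forall>s. \<gamma> differentiable (at s)) \<and>
     continuous_on UNIV (\<lambda>s. vector_derivative \<gamma> (at s)) \<and>
     (\<forall>s. norm (vector_derivative \<gamma> (at s)) = 1) \<and>
     winding_number (\<lambda>t. \<gamma> (L * t)) \<zeta> = 1"

definition interior_unit_normal ::
    "complex set \<Rightarrow> (real \<Rightarrow> complex) \<Rightarrow> real \<Rightarrow> complex \<Rightarrow> bool" where
  "interior_unit_normal \<Omega> \<gamma> s v \<longleftrightarrow>
     norm v = 1 \<and> v \<bullet> vector_derivative \<gamma> (at s) = 0 \<and>
     (\<forall>\<^sub>F t in at_right 0. \<gamma> s + t *\<^sub>R v \<in> \<Omega>)"

definition directional_deriv ::
    "complex \<Rightarrow> (complex \<Rightarrow> real) \<Rightarrow> complex \<Rightarrow> real" where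
  "directional_deriv v f z = frechet_derivative f (at z) v"

definition laplacian :: "(complex \<Rightarrow> real) \<Rightarrow> complex \<Rightarrow> real" where
  "laplacian f z =
     directional_deriv 1 (directional_deriv 1 f) z + directional_deriv \<i> (directional_deriv \<i> f) z"

fun C_k :: "nat \<Rightarrow> (complex \<Rightarrow> real) \<Rightarrow> bool" where
  "C_k 0 f \<longleftrightarrow> continuous_on UNIV f"
| "C_k (Suc k) f \<longleftrightarrow> (\<forall>z. f differentiable (at z)) \<and>
     C_k k (directional_deriv 1 f) \<and> C_k k (directional_deriv \<i> f)"

definition test_functions :: "complex set \<Rightarrow> (complex \<Rightarrow> real) set" where
  "test_functions \<Omega> =
     {\<psi>. (\<forall>k. C_k k \<psi>) \<and> (\<exists>S. compact S \<and> S \<subseteq> \<Omega> \<and> (\<forall>z. z \<notin> S \<longrightarrow> \<psi> z = 0))}"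

text \<open>The solution of \<open>-\<Delta>u = \<delta>\<^sub>\<zeta>\<close> in \<open>\<Omega>\<close>, \<open>u = 0\<close> on the boundary: the equation holds in the
  sense of distributions, the boundary values are attained continuously. The values of \<open>u\<close> at
  \<open>\<zeta>\<close> and outside the closure of \<open>\<Omega>\<close> are irrelevant.\<close>

definition solves_dirichlet_delta ::
    "complex set \<Rightarrow> complex \<Rightarrow> (complex \<Rightarrow> real) \<Rightarrow> bool" where
  "solves_dirichlet_delta \<Omega> \<zeta> u \<longleftrightarrow>
     continuous_on (closure \<Omega> - {\<zeta>}) u \<and>
     (\<forall>z \<in> frontier \<Omega>. u z = 0) \<and>
     (\<forall>S. compact S \<and> S \<subseteq> \<Omega> \<longrightarrow> set_integrable lborel S u) \<and>
     (\<forall>\<psi> \<in> test_functions \<Omega>. - (LINT z:\<Omega>|lborel. u z * laplacian \<psi> z) = \<psi> \<zeta>)"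

definition interior_normal_derivative ::
    "complex set \<Rightarrow> (real \<Rightarrow> complex) \<Rightarrow> (complex \<Rightarrow> real) \<Rightarrow> (real \<Rightarrow> real) \<Rightarrow> bool" where
  "interior_normal_derivative \<Omega> \<gamma> u \<phi> \<longleftrightarrow>
     (\<forall>s. \<exists>v. interior_unit_normal \<Omega> \<gamma> s v \<and>
        ((\<lambda>t. u (\<gamma> s + t *\<^sub>R v)) has_real_derivative \<phi> s) (at 0 within {0..}))"

definition largest_disk_in :: "complex set \<Rightarrow> complex \<Rightarrow> real \<Rightarrow> bool" where
  "largest_disk_in \<Omega> \<zeta> \<rho> \<longleftrightarrow> ball \<zeta> \<rho> \<subseteq> \<Omega> \<and> (\<forall>r. ball \<zeta> r \<subseteq> \<Omega> \<longrightarrow> r \<le> \<rho>)"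

definition smallest_disk_containing :: "complex set \<Rightarrow> complex \<Rightarrow> real \<Rightarrow> bool" where
  "smallest_disk_containing \<Omega> \<zeta> R \<longleftrightarrow> \<Omega> \<subseteq> ball \<zeta> R \<and> (\<forall>r. \<Omega> \<subseteq> ball \<zeta> r \<longrightarrow> R \<le> r)"

end

theory Submission
  imports Defs
begin

text \<open>At a boundary point \<open>q\<close> farthest from \<open>\<zeta>\<^sub>o\<close>, \<open>\<Omega>\<close> touches the circle of radius \<open>R\<close> from inside.
  By the maximum principle \<open>u\<close> lies below the Green's function of \<open>B(\<zeta>\<^sub>o, R)\<close>, and both vanish
  at \<open>q\<close>, so \<open>\<phi> \<le> 1 / (2 \<pi> R)\<close> there. Hence \<open>1 / (2 \<pi> \<rho>) - 1 / (2 \<pi> R) \<le> sup \<bar>\<phi> - C\<bar>\<close>, while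
  \<open>m \<le> \<phi>\<close> gives \<open>2 \<pi> R \<le> 1 / m\<close>; so \<open>K = \<rho> / m\<close> works, with the sup norm alone.

  The maximum principle for the distributional solution comes from testing with differences of
  radially regularised fundamental solutions, whose Laplacians are differences of mollifiers: the
  mollification of \<open>u\<close>, minus the regularised fundamental solution with pole \<open>\<zeta>\<^sub>o\<close>, does not depend
  on the mollification radius. This yields a weighted mean value property away from
  \<open>\<zeta>\<^sub>o\<close> and the upper bound \<open>u \<le> B - ln \<bar>z - \<zeta>\<^sub>o\<bar> / (2 \<pi>)\<close> near \<open>\<zeta>\<^sub>o\<close>.\<close>

subsection \<open>A smooth cutoff of the logarithm\<close>

fun times_differentiable :: "nat \<Rightarrow> (real \<Rightarrow> real) \<Rightarrow> bool" where
  "times_differentiable 0 f \<longleftrightarrow> True"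
| "times_differentiable (Suc k) f \<longleftrightarrow>
     (\<exists>f'. (\<forall>x. (f has_real_derivative f' x) (at x)) \<and> times_differentiable k f')"

lemma times_differentiable_SucI:
  "(\<And>x. (f has_real_derivative f' x) (at x)) \<Longrightarrow> times_differentiable k f' \<Longrightarrow>
    times_differentiable (Suc k) f"
  by auto

lemma times_differentiable_SucD: "times_differentiable (Suc k) f \<Longrightarrow> times_differentiable k f"
proof (induction k arbitrary: f)
  case (Suc k)
  from Suc.prems obtain f' where "\<And>x. (f has_real_derivative f' x) (at x)"
    "times_differentiable (Suc k) f'"
    by (auto simp del: times_differentiable.simps(2) simp: times_differentiable.simps(2)[of "Suc k"])
  with Suc.IH show ?case by (auto simp only: times_differentiable.simps(2))
qed simp

lemma times_differentiable_const: "times_differentiable k (\<lambda>x. c)"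
proof (induction k arbitrary: c)
  case (Suc k)
  then show ?case by (auto intro!: exI[of _ "\<lambda>x. 0"])
qed simp

lemma times_differentiable_id: "times_differentiable k (\<lambda>x. x)"
  by (cases k) (auto intro!: exI[of _ "\<lambda>x. 1"] times_differentiable_const)

lemma times_differentiable_add:
  "times_differentiable k f \<Longrightarrow> times_differentiable k g \<Longrightarrow> times_differentiable k (\<lambda>x. f x + g x)"
proof (induction k arbitrary: f g)
  case (Suc k)
  obtain f' where f': "\<And>x. (f has_real_derivative f' x) (at x)" "times_differentiable k f'"
    using Suc.prems by auto
  obtain g' where g': "\<And>x. (g has_real_derivative g' x) (at x)" "times_differentiable k g'"
    using Suc.prems by auto
  have "((\<lambda>x. f x + g x) has_real_derivative f' x + g' x) (at x)" for x
    by (intro derivative_intros f' g')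
  then show ?case using Suc.IH[OF f'(2) g'(2)] by (rule times_differentiable_SucI)
qed simp

lemma times_differentiable_mult:
  "times_differentiable k f \<Longrightarrow> times_differentiable k g \<Longrightarrow> times_differentiable k (\<lambda>x. f x * g x)"
proof (induction k arbitrary: f g)
  case (Suc k)
  obtain f' where f': "\<And>x. (f has_real_derivative f' x) (at x)" "times_differentiable k f'"
    using Suc.prems by auto
  obtain g' where g': "\<And>x. (g has_real_derivative g' x) (at x)" "times_differentiable k g'"
    using Suc.prems by auto
  have "((\<lambda>x. f x * g x) has_real_derivative f' x * g x + g' x * f x) (at x)" for x
    by (intro DERIV_mult f' g')
  moreover have "times_differentiable k (\<lambda>x. f' x * g x + g' x * f x)"
    using Suc.prems[THEN times_differentiable_SucD] f'(2) g'(2)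
    by (intro times_differentiable_add Suc.IH)
  ultimately show ?case by (rule times_differentiable_SucI)
qed simp

lemma times_differentiable_inverse:
  "times_differentiable k f \<Longrightarrow> (\<And>x. f x \<noteq> 0) \<Longrightarrow> times_differentiable k (\<lambda>x. inverse (f x))"
proof (induction k arbitrary: f)
  case (Suc k)
  obtain f' where f': "\<And>x. (f has_real_derivative f' x) (at x)" "times_differentiable k f'"
    using Suc.prems by auto
  \<comment> \<open>The derivative is written through \<open>inverse (f x)\<close> itself, so that
    the induction hypothesis applies to its factors.\<close>
  have "((\<lambda>x. inverse (f x)) has_real_derivative (- 1) * f' x * (inverse (f x) * inverse (f x))) (at x)" for x
    using DERIV_inverse_fun[OF f'(1) Suc.prems(2)] by (simp add: power2_eq_square mult.assoc)
  moreover have "times_differentiable k (\<lambda>x. (- 1) * f' x * (inverse (f x) * inverse (f x)))"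
    using Suc.IH[OF Suc.prems(1)[THEN times_differentiable_SucD] Suc.prems(2)] f'(2)
    by (intro times_differentiable_mult times_differentiable_const)
  ultimately show ?case by (rule times_differentiable_SucI)
qed simp

lemma times_differentiable_affine:
  "times_differentiable k f \<Longrightarrow> times_differentiable k (\<lambda>x. f (a * x + b))"
proof (induction k arbitrary: f)
  case (Suc k)
  obtain f' where f': "\<And>x. (f has_real_derivative f' x) (at x)" "times_differentiable k f'"
    using Suc.prems by auto
  have "((\<lambda>x. f (a * x + b)) has_real_derivative f' (a * x + b) * a) (at x)" for x
    by (rule DERIV_chain'[OF _ f'(1)]) (auto intro!: derivative_eq_intros)
  moreover have "times_differentiable k (\<lambda>x. f' (a * x + b) * a)"
    using Suc.IH[OF f'(2)] by (intro times_differentiable_mult times_differentiable_const)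
  ultimately show ?case by (rule times_differentiable_SucI)
qed simp

section \<open>The smooth function that vanishes to infinite order at the origin\<close>

definition flat :: "real \<Rightarrow> real" where
  "flat x = (if x \<le> 0 then 0 else exp (- (1 / x)))"

text \<open>A single term of the exponential series at \<open>1 / x\<close>, the one of index
  \<open>n + 2\<close>, is at most the whole sum. The two spare powers of \<open>x\<close> make
  difference quotients at 0 tend to 0.\<close>

lemma exp_neg_inverse_le:
  assumes "0 < (x::real)"
  shows "exp (- (1 / x)) / x ^ n \<le> fact (n + 2) * x\<^sup>2"
proof -
  have "(1 / x) ^ (n + 2) / fact (n + 2) = (\<Sum>i\<in>{n + 2}. (1 / x) ^ i /\<^sub>R fact i)"
    by (simp add: divide_inverse)
  also have "\<dots> \<le> (\<Sum>i. (1 / x) ^ i /\<^sub>R fact i)"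
    using assms by (intro sum_le_suminf summable_exp_generic) auto
  also have "\<dots> = exp (1 / x)" by (simp add: exp_def)
  finally have "1 / (x ^ n * x\<^sup>2) \<le> fact (n + 2) * exp (1 / x)"
    using assms by (simp add: power_add power_divide divide_le_eq ac_simps power2_eq_square del: fact_Suc)
  then have "exp (- (1 / x)) * x\<^sup>2 * (1 / (x ^ n * x\<^sup>2)) \<le> exp (- (1 / x)) * x\<^sup>2 * (fact (n + 2) * exp (1 / x))"
    by (intro mult_left_mono) auto
  also have "\<dots> = fact (n + 2) * x\<^sup>2 * (exp (- (1 / x)) * exp (1 / x))"
    by (simp only: ac_simps)
  also have "exp (- (1 / x)) * exp (1 / x) = 1"
    by (simp flip: exp_add)
  finally show ?thesis
    using assms by (simp del: fact_Suc)
qed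

text \<open>Up to linear combinations the family \<open>flat x / x ^ n\<close> is closed under
  differentiation, also at 0. Smoothness of \<open>flat\<close> thus becomes an induction on the
  order with \<open>n\<close> arbitrary.\<close>

lemma has_derivative_flat_divide_power:
  "((\<lambda>x. flat x / x ^ n) has_real_derivative - real n * (flat x / x ^ Suc n) + flat x / x ^ (n + 2)) (at x)"
proof (cases "x = 0")
  case True
  have "(\<lambda>h. flat h / h ^ n / h) \<midarrow>0\<rightarrow> 0"
  proof (rule Lim_null_comparison)
    have "norm (flat h / h ^ n / h) \<le> fact (n + 3) * h\<^sup>2" for h
    proof (cases "h \<le> 0")
      case False
      then show ?thesis using exp_neg_inverse_le[of h "Suc n"]
        by (simp add: flat_def field_simps numeral_eq_Suc)
    qed (simp add: flat_def)
    then show "\<forall>\<^sub>F h in at 0. norm (flat h / h ^ n / h) \<le> fact (n + 3) * h\<^sup>2" by simp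
    show "((\<lambda>h::real. fact (n + 3) * h\<^sup>2) \<longlongrightarrow> 0) (at 0)"
      by (auto intro!: tendsto_eq_intros)
  qed
  then show ?thesis using True by (simp add: DERIV_def flat_def[of 0])
next
  case False
  show ?thesis
  proof (cases "x < 0")
    case True
    have "((\<lambda>x::real. 0) has_real_derivative 0) (at x)" by simp
    then have "((\<lambda>x. flat x / x ^ n) has_real_derivative 0) (at x)"
      by (rule has_field_derivative_transform_within_open[of _ _ _ "{..<0}"])
        (use True in \<open>auto simp: flat_def\<close>)
    then show ?thesis using True by (simp add: flat_def)
  next
    case neg: False
    with False have x: "0 < x" by simp
    have "((\<lambda>x. exp (- (1 / x)) / x ^ n) has_real_derivative
        - real n * (flat x / x ^ Suc n) + flat x / x ^ (n + 2)) (at x)"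
    proof -
      have 1: "((\<lambda>x. inverse x ^ n) has_real_derivative - real n * inverse x ^ Suc n) (at x)"
      proof (cases n)
        case (Suc m)
        then show ?thesis
          using DERIV_power_Suc[OF DERIV_inverse, of x m] x by (simp add: algebra_simps)
      qed simp
      have 2: "((\<lambda>x. exp (- inverse x)) has_real_derivative exp (- inverse x) * inverse x ^ 2) (at x)"
        using x by (auto intro!: derivative_eq_intros simp: power2_eq_square)
      from DERIV_mult[OF 2 1] have "((\<lambda>x. exp (- inverse x) * inverse x ^ n) has_real_derivative
          - real n * (exp (- inverse x) * inverse x ^ Suc n) + exp (- inverse x) * inverse x ^ (n + 2)) (at x)"
        by (rule DERIV_cong) (simp add: algebra_simps power_add power2_eq_square)
      then show ?thesis using x by (simp add: flat_def divide_inverse power_inverse)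
    qed
    then show ?thesis
      by (rule has_field_derivative_transform_within_open[of _ _ _ "{0<..}"])
        (use x in \<open>auto simp: flat_def\<close>)
  qed
qed

lemma times_differentiable_flat_divide_power: "times_differentiable k (\<lambda>x. flat x / x ^ n)"
proof (induction k arbitrary: n)
  case (Suc k)
  have "times_differentiable k (\<lambda>x. - real n * (flat x / x ^ Suc n) + flat x / x ^ (n + 2))"
    by (intro times_differentiable_add times_differentiable_mult times_differentiable_const Suc)
  with has_derivative_flat_divide_power show ?case by (rule times_differentiable_SucI)
qed simp

lemma times_differentiable_flat: "times_differentiable k flat"
  using times_differentiable_flat_divide_power[of k 0] by simp

lemma flat_nonneg: "0 \<le> flat x" and flat_pos: "0 < x \<Longrightarrow> 0 < flat x"
  and flat_eq_0: "x \<le> 0 \<Longrightarrow> flat x = 0"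
  by (auto simp: flat_def)

lemma flat_mono: "x \<le> y \<Longrightarrow> flat x \<le> flat y"
  by (auto simp: flat_def field_simps)

text \<open>The usual quotient of flat functions, a smooth transition from 0 to 1 between
  \<open>s = 1\<close> and \<open>s = 2\<close>. The variable \<open>s\<close> will be a squared,
  rescaled radius.\<close>

definition step :: "real \<Rightarrow> real" where
  "step s = flat (s - 1) / (flat (s - 1) + flat (2 - s))"

text \<open>The arguments \<open>s - 1\<close> and \<open>2 - s\<close> add up to 1, so at least one
  of them is positive.\<close>

lemma step_denominator_pos: "0 < flat (s - 1) + flat (2 - s)"
  using flat_pos[of "s - 1"] flat_pos[of "2 - s"] flat_nonneg[of "s - 1"] flat_nonneg[of "2 - s"]
  by (cases "s > 1") auto

lemma times_differentiable_step: "times_differentiable k step"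
proof -
  have "times_differentiable k (\<lambda>s. flat (1 * s + - 1))"
    "times_differentiable k (\<lambda>s. flat (- 1 * s + 2))"
    by (intro times_differentiable_affine times_differentiable_flat)+
  then have *: "times_differentiable k (\<lambda>s. flat (s - 1))" "times_differentiable k (\<lambda>s. flat (2 - s))"
    by (simp_all add: algebra_simps)
  have "flat (s - 1) + flat (2 - s) \<noteq> 0" for s using step_denominator_pos[of s] by simp
  then have "times_differentiable k (\<lambda>s. flat (s - 1) * inverse (flat (s - 1) + flat (2 - s)))"
    by (intro times_differentiable_mult times_differentiable_inverse times_differentiable_add *)
  then show ?thesis by (simp add: step_def[abs_def] divide_inverse)
qed

lemma step_eq_0: "s \<le> 1 \<Longrightarrow> step s = 0" and step_eq_1: "2 \<le> s \<Longrightarrow> step s = 1"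
  using flat_pos[of "s - 1"] by (auto simp: step_def flat_eq_0)

lemma step_mono: "mono step"
proof
  fix x y :: real assume "x \<le> y"
  \<comment> \<open>Clearing denominators in \<open>step x \<le> step y\<close> leaves exactly this,
    since the product \<open>flat (x - 1) * flat (y - 1)\<close> occurs on both sides.\<close>
  then have "flat (x - 1) * flat (2 - y) \<le> flat (y - 1) * flat (2 - x)"
    by (intro mult_mono flat_mono flat_nonneg) auto
  then show "step x \<le> step y"
    using step_denominator_pos[of x] step_denominator_pos[of y]
    by (simp add: step_def divide_simps) (simp add: algebra_simps)
qed

lemma DERIV_step: "(step has_real_derivative deriv step s) (at s)"
  using times_differentiable_step[of 1] by (metis DERIV_imp_deriv One_nat_def times_differentiable.simps(2))

lemma times_differentiable_deriv_step: "times_differentiable k (deriv step)"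
proof -
  obtain f' where f': "\<And>x. (step has_real_derivative f' x) (at x)" "times_differentiable k f'"
    using times_differentiable_step[of "Suc k"] by auto
  then have "deriv step = f'" by (auto intro: DERIV_imp_deriv)
  with f' show ?thesis by simp
qed

lemma isCont_deriv_step: "isCont (deriv step) s"
  using times_differentiable_deriv_step[of 1] by (auto dest: DERIV_isCont)

lemma deriv_step_nonneg: "0 \<le> deriv step s"
  by (rule mono_on_imp_deriv_nonneg[OF step_mono DERIV_step]) simp

lemma deriv_step_eq_0:
  assumes "s < 1 \<or> 2 < s"
  shows "deriv step s = 0"
proof -
  have "(step has_real_derivative 0) (at s)"
  proof (cases "s < 1")
    case True
    have "((\<lambda>_. 0) has_real_derivative 0) (at s)" by simp
    then show ?thesis
      by (rule has_field_derivative_transform_within_open[of _ _ _ "{..<1}"])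
        (use True in \<open>auto simp: step_eq_0\<close>)
  next
    case False
    have "((\<lambda>_. 1) has_real_derivative 0) (at s)" by simp
    then show ?thesis
      by (rule has_field_derivative_transform_within_open[of _ _ _ "{2<..}"])
        (use False assms in \<open>auto simp: step_eq_1\<close>)
  qed
  then show ?thesis by (rule DERIV_imp_deriv)
qed

text \<open>The factor \<open>s * inverse (s * s + flat (1 - s))\<close> is a smooth extension to the whole line of
  \<open>1 / s\<close> from \<open>s \<ge> 1\<close>, the only place where \<open>step\<close> does not vanish.\<close>

definition profile_deriv :: "real \<Rightarrow> real" where
  "profile_deriv s = - (step s * s * inverse (s * s + flat (1 - s))) / (4 * pi)"

text \<open>An antiderivative, normalised at 2 so as to continue as
  \<open>- ln s / (4 * pi)\<close>. With \<open>s\<close> a squared radius this is the fundamental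
  solution of minus the Laplacian in the plane.\<close>

definition profile :: "real \<Rightarrow> real" where
  "profile = (SOME f. (\<forall>s. (f has_real_derivative profile_deriv s) (at s)) \<and> f 2 = - ln 2 / (4 * pi))"

lemma times_differentiable_profile_deriv: "times_differentiable k profile_deriv"
proof -
  have "times_differentiable k (\<lambda>s. flat (- 1 * s + 1))"
    by (intro times_differentiable_affine times_differentiable_flat)
  then have *: "times_differentiable k (\<lambda>s. flat (1 - s))"
    by (simp add: algebra_simps)
  have "s * s + flat (1 - s) \<noteq> 0" for s
    using flat_pos[of "1 - s"] flat_nonneg[of "1 - s"]
    by (cases "s = 0") (auto simp: add_nonneg_eq_0_iff)
  then have "times_differentiable k
      (\<lambda>s. (- 1 / (4 * pi)) * (step s * s * inverse (s * s + flat (1 - s))))"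
    by (intro times_differentiable_mult times_differentiable_inverse times_differentiable_add *
        times_differentiable_const times_differentiable_id times_differentiable_step)
  then show ?thesis by (simp add: profile_deriv_def[abs_def])
qed

text \<open>For \<open>s > 1\<close> the flat term vanishes and the smooth factor is
  \<open>1 / s\<close>; for \<open>s \<le> 1\<close> the step is 0 on both sides. The product is, up
  to a constant, the radial flux, and its derivative will give the Laplacian.\<close>

lemma mult_profile_deriv: "s * profile_deriv s = - step s / (4 * pi)"
proof (cases "s \<le> 1")
  case False
  then show ?thesis by (simp add: profile_deriv_def flat_eq_0 field_simps)
qed (simp add: profile_deriv_def step_eq_0)

lemma profile_properties:
  "(\<forall>s. (profile has_real_derivative profile_deriv s) (at s)) \<and> profile 2 = - ln 2 / (4 * pi)"
proof -
  have "isCont profile_deriv s" for s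
    using times_differentiable_profile_deriv[of 1] by (auto dest: DERIV_isCont)
  then obtain f where f: "\<And>s. (f has_vector_derivative profile_deriv s) (at s)"
    using einterval_antiderivative[of "-\<infinity>" "\<infinity>" profile_deriv] by auto
  have "((\<lambda>s. f s - f 2 - ln 2 / (4 * pi)) has_real_derivative profile_deriv s) (at s)" for s
    using f[of s] by (auto intro!: derivative_eq_intros simp: has_real_derivative_iff_has_vector_derivative)
  then have "\<exists>f. (\<forall>s. (f has_real_derivative profile_deriv s) (at s)) \<and> f 2 = - ln 2 / (4 * pi)"
    by (intro exI[of _ "\<lambda>s. f s - f 2 - ln 2 / (4 * pi)"]) auto
  then show ?thesis
    unfolding profile_def by (rule someI_ex)
qed

lemma DERIV_profile: "(profile has_real_derivative profile_deriv s) (at s)"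
  using profile_properties by simp

lemma times_differentiable_profile: "times_differentiable k profile"
  by (rule times_differentiable_SucD[OF times_differentiable_SucI[OF DERIV_profile
      times_differentiable_profile_deriv]])

text \<open>From 2 on the step equals 1, so both sides have the same derivative there, and the
  normalisation at 2 makes them agree.\<close>

lemma profile_eq_ln:
  assumes "2 \<le> s"
  shows "profile s = - ln s / (4 * pi)"
proof -
  have "profile_deriv t = - (1 / t) / (4 * pi)" if "2 \<le> t" for t
    using mult_profile_deriv[of t] that by (simp add: step_eq_1 field_simps)
  then have *: "((\<lambda>t. profile t + ln t / (4 * pi)) has_real_derivative 0) (at t)" if "2 \<le> t" for t
    using that by (auto intro!: derivative_eq_intros DERIV_profile)
  have "profile s + ln s / (4 * pi) = profile 2 + ln 2 / (4 * pi)"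
  proof (cases "s = 2")
    case False
    have "continuous_on {2..s} (\<lambda>t. profile t + ln t / (4 * pi))"
      by (rule DERIV_continuous_on, rule has_field_derivative_at_within, rule *) simp
    then show ?thesis
      using False assms * by (intro DERIV_isconst_end) auto
  qed simp
  then show ?thesis using profile_properties by simp
qed

subsection \<open>Radial test functions\<close>

lemma directional_deriv_eq:
  "(f has_derivative f') (at z) \<Longrightarrow> directional_deriv v f z = f' v"
  unfolding directional_deriv_def using frechet_derivative_at by metis

lemma directional_deriv_diff:
  "f differentiable at z \<Longrightarrow> g differentiable at z \<Longrightarrow>
    directional_deriv v (\<lambda>z. f z - g z) z = directional_deriv v f z - directional_deriv v g z"
  unfolding directional_deriv_def
  by (subst frechet_derivative_at[symmetric, OF has_derivative_diff])
    (auto simp: frechet_derivative_works[symmetric])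

lemma C_k_SucI:
  assumes "\<And>z. (f has_derivative D z) (at z)"
    and "C_k k (\<lambda>z. D z 1)" "C_k k (\<lambda>z. D z \<i>)"
  shows "C_k (Suc k) f"
proof -
  have "directional_deriv v f = (\<lambda>z. D z v)" for v
    using directional_deriv_eq[OF assms(1)] by auto
  then show ?thesis using assms by (auto simp: differentiable_def)
qed

lemma C_k_SucD: "C_k (Suc k) f \<Longrightarrow> C_k k f"
proof (induction k arbitrary: f)
  case 0
  then show ?case
    by (auto intro!: differentiable_imp_continuous_on simp: differentiable_on_def
        intro: differentiable_at_withinI)
next
  case (Suc k)
  from Suc.prems show ?case
    by (simp only: C_k.simps(2)[of "Suc k" f] C_k.simps(2)[of k f]) (blast intro: Suc.IH)
qed

lemma C_k_SucE:
  assumes "C_k (Suc k) f"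
  obtains D where "\<And>z. (f has_derivative D z) (at z)" "C_k k (\<lambda>z. D z 1)" "C_k k (\<lambda>z. D z \<i>)"
    "C_k k f"
proof
  show "(f has_derivative frechet_derivative f (at z)) (at z)" for z
    using assms by (auto simp: frechet_derivative_works[symmetric])
qed (use assms C_k_SucD[OF assms] in \<open>auto simp: directional_deriv_def[abs_def]\<close>)

lemma C_k_const: "C_k k (\<lambda>z. c)"
proof (induction k arbitrary: c)
  case (Suc k)
  show ?case by (rule C_k_SucI[OF has_derivative_const]) (rule Suc)+
qed auto

lemma C_k_bounded_linear:
  assumes "bounded_linear f"
  shows "C_k k f"
proof (cases k)
  case 0
  then show ?thesis using linear_continuous_on[OF assms] by simp
next
  case (Suc j)
  show ?thesis unfolding Suc
    by (rule C_k_SucI[OF bounded_linear_imp_has_derivative[OF assms]]) (rule C_k_const)+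
qed

lemma C_k_add: "C_k k f \<Longrightarrow> C_k k g \<Longrightarrow> C_k k (\<lambda>z. f z + g z)"
proof (induction k arbitrary: f g)
  case (Suc k)
  from Suc.prems(1) obtain D where D: "\<And>z. (f has_derivative D z) (at z)"
    "C_k k (\<lambda>z. D z 1)" "C_k k (\<lambda>z. D z \<i>)" "C_k k f" by (rule C_k_SucE) blast
  from Suc.prems(2) obtain E where E: "\<And>z. (g has_derivative E z) (at z)"
    "C_k k (\<lambda>z. E z 1)" "C_k k (\<lambda>z. E z \<i>)" "C_k k g" by (rule C_k_SucE) blast
  show ?case
    by (rule C_k_SucI[OF has_derivative_add[OF D(1) E(1)]]) (intro Suc.IH D(2-3) E(2-3))+
qed (auto intro: continuous_on_add)

lemma C_k_mult: "C_k k f \<Longrightarrow> C_k k g \<Longrightarrow> C_k k (\<lambda>z. f z * g z)"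
proof (induction k arbitrary: f g)
  case (Suc k)
  from Suc.prems(1) obtain D where D: "\<And>z. (f has_derivative D z) (at z)"
    "C_k k (\<lambda>z. D z 1)" "C_k k (\<lambda>z. D z \<i>)" "C_k k f" by (rule C_k_SucE) blast
  from Suc.prems(2) obtain E where E: "\<And>z. (g has_derivative E z) (at z)"
    "C_k k (\<lambda>z. E z 1)" "C_k k (\<lambda>z. E z \<i>)" "C_k k g" by (rule C_k_SucE) blast
  show ?case
    by (rule C_k_SucI[OF has_derivative_mult[OF D(1) E(1)]]) (intro C_k_add Suc.IH D(2-) E(2-))+
qed (auto intro: continuous_on_mult)

text \<open>One extra order is asked of \<open>f\<close> because \<open>C_k k\<close> includes
  continuity of the last derivatives, whereas \<open>times_differentiable k\<close> only provides
  their existence.\<close>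

lemma C_k_compose:
  "times_differentiable (Suc k) f \<Longrightarrow> C_k k q \<Longrightarrow> C_k k (\<lambda>z. f (q z))"
proof (induction k arbitrary: f)
  case 0
  then have "isCont f x" for x by (auto dest: DERIV_isCont)
  then have "continuous_on UNIV f" by (simp add: continuous_at_imp_continuous_on)
  with 0 show ?case by (auto intro: continuous_on_compose2)
next
  case (Suc k)
  from Suc.prems(1) obtain f' where f': "\<And>x. (f has_real_derivative f' x) (at x)"
    "times_differentiable (Suc k) f'" by (auto simp only: times_differentiable.simps(2)[of "Suc k"])
  from Suc.prems(2) obtain D where D: "\<And>z. (q has_derivative D z) (at z)"
    "C_k k (\<lambda>z. D z 1)" "C_k k (\<lambda>z. D z \<i>)" "C_k k q" by (rule C_k_SucE) blast
  have "((\<lambda>z. f (q z)) has_derivative (\<lambda>v. f' (q z) * D z v)) (at z)" for z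
    using has_derivative_compose[OF D(1) f'(1)[unfolded has_field_derivative_def]] .
  then show ?case
    by (rule C_k_SucI) (rule C_k_mult[OF Suc.IH[OF f'(2) D(4)]], rule D)+
qed

text \<open>The squared norm is a polynomial in the coordinates. Radial functions are therefore
  written through it, which keeps them smooth at the centre.\<close>

lemma C_k_norm_square: "C_k k (\<lambda>y. (norm (y - z) / \<epsilon>)\<^sup>2)"
proof -
  have "C_k k (\<lambda>y. ((Re y + - Re z) * (Re y + - Re z) + (Im y + - Im z) * (Im y + - Im z)) * (1 / \<epsilon>\<^sup>2))"
    by (intro C_k_mult C_k_add C_k_const C_k_bounded_linear bounded_linear_Re bounded_linear_Im)
  also have "(\<lambda>y. ((Re y + - Re z) * (Re y + - Re z) + (Im y + - Im z) * (Im y + - Im z)) * (1 / \<epsilon>\<^sup>2))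
      = (\<lambda>y. (norm (y - z) / \<epsilon>)\<^sup>2)"
    by (simp add: power_divide cmod_power2 flip: power2_eq_square)
  finally show ?thesis .
qed

lemma laplacian_diff:
  assumes "C_k (Suc (Suc 0)) f" "C_k (Suc (Suc 0)) g"
  shows "laplacian (\<lambda>z. f z - g z) z = laplacian f z - laplacian g z"
proof -
  have "directional_deriv v (\<lambda>z. f z - g z) = (\<lambda>z. directional_deriv v f z - directional_deriv v g z)" for v
    using assms by (intro ext directional_deriv_diff) auto
  then show ?thesis using assms by (simp add: laplacian_def directional_deriv_diff)
qed

text \<open>With q = |y - z|^2 / \<epsilon>^2, the Laplacian of q is 4 / \<epsilon>^2 and its
  squared gradient is 4 q / \<epsilon>^2; the chain rule multiplies the first by \<open>p1\<close>
  and the second by \<open>p2\<close>.\<close>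

lemma laplacian_radial:
  assumes p: "\<And>s. (p has_real_derivative p1 s) (at s)" and p1: "\<And>s. (p1 has_real_derivative p2 s) (at s)"
    and "\<epsilon> \<noteq> 0"
  shows "laplacian (\<lambda>y. p ((norm (y - z) / \<epsilon>)\<^sup>2) - c) y =
    4 / \<epsilon>\<^sup>2 * (p1 ((norm (y - z) / \<epsilon>)\<^sup>2) + (norm (y - z) / \<epsilon>)\<^sup>2 * p2 ((norm (y - z) / \<epsilon>)\<^sup>2))"
proof -
  define q where "q = (\<lambda>y. (norm (y - z) / \<epsilon>)\<^sup>2)"
  have q: "(q has_derivative (\<lambda>v. 2 * ((y - z) \<bullet> v) / \<epsilon>\<^sup>2)) (at y)" for y
  proof -
    have "((\<lambda>y. ((y - z) \<bullet> (y - z)) * c) has_derivative (\<lambda>v. 2 * ((y - z) \<bullet> v) * c)) (at y)" for c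
      by (auto intro!: derivative_eq_intros simp: inner_commute)
    from this[of "1 / \<epsilon>\<^sup>2"] show ?thesis by (simp add: q_def power_divide power2_norm_eq_inner)
  qed
  have 1: "((\<lambda>y. p (q y) - c) has_derivative (\<lambda>v. p1 (q y) * (2 * ((y - z) \<bullet> v) / \<epsilon>\<^sup>2))) (at y)" for y
    using has_derivative_diff[OF has_derivative_compose[OF q p[unfolded has_field_derivative_def]] has_derivative_const]
    by simp
  have dd: "directional_deriv v (\<lambda>y. p (q y) - c) = (\<lambda>y. p1 (q y) * (2 * ((y - z) \<bullet> v) / \<epsilon>\<^sup>2))" for v
    using directional_deriv_eq[OF 1] by auto
  have 2: "((\<lambda>y. p1 (q y)) has_derivative (\<lambda>v. p2 (q y) * (2 * ((y - z) \<bullet> v) / \<epsilon>\<^sup>2))) (at y)" for y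
    using has_derivative_compose[OF q p1[unfolded has_field_derivative_def]] .
  have 3: "((\<lambda>y. 2 * ((y - z) \<bullet> v) / \<epsilon>\<^sup>2) has_derivative (\<lambda>w. 2 * (w \<bullet> v) / \<epsilon>\<^sup>2)) (at y)" for v y
  proof -
    have "((\<lambda>y. 2 * ((y - z) \<bullet> v) * c) has_derivative (\<lambda>w. 2 * (w \<bullet> v) * c)) (at y)" for c
      by (auto intro!: derivative_eq_intros)
    from this[of "inverse (\<epsilon>\<^sup>2)"] show ?thesis by (simp add: divide_inverse)
  qed
  have dd2: "directional_deriv v (directional_deriv v (\<lambda>y. p (q y) - c)) y =
     p1 (q y) * (2 * (v \<bullet> v) / \<epsilon>\<^sup>2) + p2 (q y) * (2 * ((y - z) \<bullet> v) / \<epsilon>\<^sup>2)\<^sup>2" for v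
    unfolding dd using directional_deriv_eq[OF has_derivative_mult[OF 2 3]] by (simp add: power2_eq_square)
  have "laplacian (\<lambda>y. p (q y) - c) y = 4 / \<epsilon>\<^sup>2 * p1 (q y) +
      p2 (q y) * ((2 * ((y - z) \<bullet> 1) / \<epsilon>\<^sup>2)\<^sup>2 + (2 * ((y - z) \<bullet> \<i>) / \<epsilon>\<^sup>2)\<^sup>2)"
    unfolding laplacian_def dd2 by (simp only: distrib_left) (simp add: inner_complex_def)
  also have "(2 * ((y - z) \<bullet> 1) / \<epsilon>\<^sup>2)\<^sup>2 + (2 * ((y - z) \<bullet> \<i>) / \<epsilon>\<^sup>2)\<^sup>2 =
      4 / \<epsilon>\<^sup>2 * ((((y - z) \<bullet> 1)\<^sup>2 + ((y - z) \<bullet> \<i>)\<^sup>2) / \<epsilon>\<^sup>2)"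
  proof -
    have "(2 * a / \<epsilon>\<^sup>2)\<^sup>2 + (2 * b / \<epsilon>\<^sup>2)\<^sup>2 = 4 / \<epsilon>\<^sup>2 * ((a\<^sup>2 + b\<^sup>2) / \<epsilon>\<^sup>2)" for a b
      by (simp add: power2_eq_square add_divide_distrib)
    then show ?thesis .
  qed
  also have "(((y - z) \<bullet> 1)\<^sup>2 + ((y - z) \<bullet> \<i>)\<^sup>2) / \<epsilon>\<^sup>2 = q y"
    by (simp add: q_def cmod_power2 power_divide inner_complex_def)
  finally show ?thesis by (simp add: q_def distrib_left ac_simps)
qed

section \<open>The mollifier and the regularised fundamental solution\<close>

definition mollifier :: "real \<Rightarrow> complex \<Rightarrow> real" where
  "mollifier \<epsilon> h = deriv step ((norm h / \<epsilon>)\<^sup>2) / (pi * \<epsilon>\<^sup>2)"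

text \<open>The subtracted constant undoes the rescaling by \<epsilon>, so that away from the centre
  the logarithm itself appears, whatever the radius.\<close>

definition log_regularised :: "real \<Rightarrow> complex \<Rightarrow> real" where
  "log_regularised \<epsilon> h = profile ((norm h / \<epsilon>)\<^sup>2) - ln \<epsilon> / (2 * pi)"

lemma log_regularised_eq_ln:
  assumes "0 < \<epsilon>" "2 * \<epsilon> \<le> norm h"
  shows "log_regularised \<epsilon> h = - ln (norm h) / (2 * pi)"
proof -
  have "2 \<le> norm h / \<epsilon>" using assms by (simp add: field_simps)
  then have "2\<^sup>2 \<le> (norm h / \<epsilon>)\<^sup>2" by (intro power_mono) auto
  then have "profile ((norm h / \<epsilon>)\<^sup>2) = - ln ((norm h / \<epsilon>)\<^sup>2) / (4 * pi)"
    by (intro profile_eq_ln) simp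
  also have "ln ((norm h / \<epsilon>)\<^sup>2) = 2 * (ln (norm h) - ln \<epsilon>)"
    using assms by (subst ln_realpow) (auto simp: ln_div)
  also have "- (2 * (ln (norm h) - ln \<epsilon>)) / (4 * pi) = ln \<epsilon> / (2 * pi) - ln (norm h) / (2 * pi)"
    by (simp add: divide_simps)
  finally show ?thesis by (simp add: log_regularised_def)
qed

lemma C_k_log_regularised: "C_k k (\<lambda>y. log_regularised \<epsilon> (y - z))"
proof -
  have "C_k k (\<lambda>y. profile ((norm (y - z) / \<epsilon>)\<^sup>2) + - (ln \<epsilon> / (2 * pi)))"
    by (rule C_k_add[OF C_k_compose[OF times_differentiable_profile C_k_norm_square] C_k_const])
  then show ?thesis by (simp add: log_regularised_def)
qed

lemma laplacian_log_regularised: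
  assumes "0 < \<epsilon>"
  shows "laplacian (\<lambda>y. log_regularised \<epsilon> (y - z)) y = - mollifier \<epsilon> (y - z)"
proof -
  obtain p2 where p2: "\<And>s. (profile_deriv has_real_derivative p2 s) (at s)"
    using times_differentiable_profile_deriv[of 1] by auto
  \<comment> \<open>The left side is the expression from \<open>laplacian_radial\<close>, and it is
    the derivative of \<open>s * profile_deriv s\<close>. Differentiating the closed form of that
    product gives the right side.\<close>
  have *: "profile_deriv s + s * p2 s = - deriv step s / (4 * pi)" for s
  proof -
    have "((\<lambda>s. s * profile_deriv s) has_real_derivative profile_deriv s + s * p2 s) (at s)"
      by (auto intro!: derivative_eq_intros p2)
    moreover have "((\<lambda>s. s * profile_deriv s) has_real_derivative - deriv step s / (4 * pi)) (at s)"
      unfolding mult_profile_deriv by (auto intro!: derivative_eq_intros DERIV_step)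
    ultimately show ?thesis by (rule DERIV_unique)
  qed
  show ?thesis
    unfolding log_regularised_def
    by (subst laplacian_radial[OF DERIV_profile p2 less_imp_neq[OF assms, symmetric]])
      (auto simp: * mollifier_def)
qed

lemma mollifier_nonneg: "0 \<le> mollifier \<epsilon> h"
  by (simp add: mollifier_def deriv_step_nonneg)

text \<open>The factor \<open>deriv step\<close> confines the support to an annulus from radius
  \<epsilon> to sqrt 2 times \<epsilon>; 2 \<epsilon> is a rounder bound. The hole in the middle
  later gives a gap uniform in \<open>h\<close>.\<close>

lemma mollifier_eq_0:
  assumes "0 < \<epsilon>" "norm h < \<epsilon> \<or> 2 * \<epsilon> < norm h"
  shows "mollifier \<epsilon> h = 0"
proof -
  have "(norm h / \<epsilon>)\<^sup>2 < 1 \<or> 2 < (norm h / \<epsilon>)\<^sup>2"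
    using assms(2)
  proof
    assume "norm h < \<epsilon>"
    then show ?thesis using assms by (intro disjI1 power_Suc_less_one[of _ 1, simplified])
       (auto simp: power2_eq_square[symmetric] abs_square_less_1)
  next
    assume "2 * \<epsilon> < norm h"
    then have "2 < norm h / \<epsilon>" using assms by (simp add: field_simps)
    then have "2 < norm h / \<epsilon> * (norm h / \<epsilon>)" by (smt (verit) mult_less_cancel_left2)
    then show ?thesis by (simp add: power2_eq_square)
  qed
  then show ?thesis by (simp add: mollifier_def deriv_step_eq_0)
qed

lemma continuous_on_mollifier: "continuous_on UNIV (mollifier \<epsilon>)"
proof -
  have "continuous_on UNIV (deriv step)"
    by (simp add: continuous_at_imp_continuous_on isCont_deriv_step)
  then have "continuous_on UNIV (\<lambda>h::complex. deriv step ((norm h * c)\<^sup>2))" for c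
    by (rule continuous_on_compose2) (auto intro!: continuous_intros)
  then have "continuous_on UNIV (\<lambda>h::complex. deriv step ((norm h * c)\<^sup>2) * d)" for c d
    by (intro continuous_intros)
  from this[of "1 / \<epsilon>" "1 / (pi * \<epsilon>\<^sup>2)"] show ?thesis by (simp add: mollifier_def[abs_def])
qed

lemma mollifier_bounded: "\<exists>B. \<forall>h. mollifier \<epsilon> h \<le> B" if "0 < \<epsilon>"
proof -
  have "compact (mollifier \<epsilon> ` cball 0 (2 * \<epsilon>))"
    by (intro compact_continuous_image continuous_on_subset[OF continuous_on_mollifier]) auto
  then obtain B where B: "\<And>h. norm h \<le> 2 * \<epsilon> \<Longrightarrow> \<bar>mollifier \<epsilon> h\<bar> \<le> B"
    by (force dest!: compact_imp_bounded simp: bounded_iff)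
  show ?thesis
    using B mollifier_eq_0[OF that] by (intro exI[of _ "max B 0"]) (metis abs_le_D1 le_max_iff_disj linorder_not_less order_refl)
qed

subsection \<open>Mollification of the solution\<close>

text \<open>Integration in the squared radius: a disk of radius r has area pi r^2. The minus sign
  turns the rays \<open>{x<..}\<close>, on which the two measures are compared, into preimages that
  are bounded disks and hence of finite measure.\<close>

lemma distr_minus_norm_square:
  "distr lborel borel (\<lambda>h::complex. - (norm h)\<^sup>2) = density lborel (\<lambda>s. ennreal (pi * indicator {..0} s))"
    (is "?M = ?N")
proof (rule measure_eqI_lessThan)
  have M: "emeasure ?M {x<..} = ennreal (pi * max 0 (- x))" for x
  proof -
    have "emeasure ?M {x<..} = emeasure lborel ((\<lambda>h::complex. - (norm h)\<^sup>2) -` {x<..} \<inter> space lborel)"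
      by (intro emeasure_distr) auto
    also have "(\<lambda>h::complex. - (norm h)\<^sup>2) -` {x<..} \<inter> space lborel = ball 0 (sqrt (max 0 (- x)))"
    proof -
      have "x < - (norm h)\<^sup>2 \<longleftrightarrow> norm h < sqrt (max 0 (- x))" for h :: complex
      proof -
        have "norm h < sqrt (max 0 (- x)) \<longleftrightarrow> sqrt ((norm h)\<^sup>2) < sqrt (max 0 (- x))" by simp
        also have "\<dots> \<longleftrightarrow> (norm h)\<^sup>2 < max 0 (- x)" by (rule real_sqrt_less_iff)
        also have "\<dots> \<longleftrightarrow> x < - (norm h)\<^sup>2" using zero_le_power2[of "norm h"] by linarith
        finally show ?thesis ..
      qed
      then show ?thesis by auto
    qed
    also have "emeasure lborel \<dots> = ennreal (pi * max 0 (- x))"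
      by (subst emeasure_ball) (auto simp: unit_ball_vol_2)
    finally show ?thesis .
  qed
  then show "emeasure ?M {x<..} < \<infinity>" for x by simp
  show "emeasure ?M {x<..} = emeasure ?N {x<..}" for x
  proof -
    have "emeasure ?N {x<..} = (\<integral>\<^sup>+s. ennreal (pi * indicator {..0} s) * indicator {x<..} s \<partial>lborel)"
      by (intro emeasure_density) auto
    also have "\<dots> = (\<integral>\<^sup>+s. ennreal pi * indicator {x<..0} s \<partial>lborel)"
      by (intro nn_integral_cong) (auto split: split_indicator)
    also have "\<dots> = ennreal pi * emeasure lborel {x<..0}"
      by (intro nn_integral_cmult_indicator) auto
    also have "\<dots> = ennreal (pi * max 0 (- x))"
    proof (cases "x \<le> 0")
      case True
      then show ?thesis by (simp add: ennreal_mult'[symmetric])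
    qed simp
    finally show ?thesis using M by simp
  qed
qed auto

lemma integrable_mollifier:
  assumes "0 < \<epsilon>"
  shows "integrable lborel (mollifier \<epsilon>)"
proof -
  have "integrable lborel (\<lambda>h. indicator (cball 0 (2 * \<epsilon>)) h *\<^sub>R mollifier \<epsilon> h)"
    by (intro borel_integrable_compact continuous_on_subset[OF continuous_on_mollifier]) auto
  also have "(\<lambda>h. indicator (cball 0 (2 * \<epsilon>)) h *\<^sub>R mollifier \<epsilon> h) = mollifier \<epsilon>"
    using mollifier_eq_0[OF assms] by (auto split: split_indicator)
  finally show ?thesis .
qed

lemma integral_mollifier:
  assumes "0 < \<epsilon>"
  shows "(LINT h|lborel. mollifier \<epsilon> h) = 1"
proof -
  define g where "g s = deriv step (s * (- 1 / \<epsilon>\<^sup>2)) / (pi * \<epsilon>\<^sup>2)" for s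
  have cont: "isCont g s" for s
    unfolding g_def divide_inverse
    by (intro continuous_intros isCont_o2[OF _ isCont_deriv_step])
  then have "continuous_on UNIV g" by (simp add: continuous_at_imp_continuous_on)
  then have [measurable]: "g \<in> borel_measurable borel" by (rule borel_measurable_continuous_onI)
  have "(LINT h|lborel. mollifier \<epsilon> h) = (LINT h|lborel. g (- (norm (h::complex))\<^sup>2))"
    by (simp add: mollifier_def g_def power_divide)
  also have "\<dots> = integral\<^sup>L (distr lborel borel (\<lambda>h::complex. - (norm h)\<^sup>2)) g"
    by (rule integral_distr[symmetric]) auto
  also have "\<dots> = (LINT s|lborel. (pi * indicator {..0} s) *\<^sub>R g s)"
    unfolding distr_minus_norm_square by (rule integral_density) (auto simp: indicator_def)
  \<comment> \<open>Below \<open>- 3 * \<epsilon>\<^sup>2\<close> the argument of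
    \<open>deriv step\<close> exceeds 3, where it vanishes. This leaves a compact interval for the
    fundamental theorem, whose endpoints contribute \<open>step 3 - step 0\<close>.\<close>
  also have "\<dots> = (LINT s|lborel. (pi * g s) * indicator {- 3 * \<epsilon>\<^sup>2..0} s)"
  proof (rule Bochner_Integration.integral_cong)
    fix s :: real
    show "(pi * indicator {..0} s) *\<^sub>R g s = pi * g s * indicator {- 3 * \<epsilon>\<^sup>2..0} s"
    proof (cases "s < - 3 * \<epsilon>\<^sup>2")
      case True
      then have "3 * \<epsilon>\<^sup>2 < - s" by simp
      moreover have "0 < \<epsilon>\<^sup>2" using assms by simp
      ultimately have "3 < - s / \<epsilon>\<^sup>2" by (simp only: pos_less_divide_eq)
      then have "2 < s * (- 1 / \<epsilon>\<^sup>2)" by simp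
      then show ?thesis using True by (simp add: g_def deriv_step_eq_0)
    qed (auto simp: indicator_def)
  qed simp
  also have "\<dots> = - step (0 * (- 1 / \<epsilon>\<^sup>2)) - - step ((- 3 * \<epsilon>\<^sup>2) * (- 1 / \<epsilon>\<^sup>2))"
  proof (rule integral_FTC_Icc_real)
    fix s
    have "((\<lambda>s. - step (s * c)) has_real_derivative - (deriv step (s * c) * c)) (at s)" for c
      by (intro DERIV_minus DERIV_chain'[OF _ DERIV_step, of "\<lambda>s. s * c" c]) (auto intro!: derivative_eq_intros)
    from this[of "- 1 / \<epsilon>\<^sup>2"]
    show "((\<lambda>s. - step (s * (- 1 / \<epsilon>\<^sup>2))) has_real_derivative pi * g s) (at s)"
      by (simp add: g_def)
    show "isCont (\<lambda>s. pi * g s) s" by (intro continuous_intros cont)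
  qed (use assms in auto)
  also have "\<dots> = 1" using assms by (simp add: step_eq_0 step_eq_1)
  finally show ?thesis .
qed

text \<open>The preimage of a box under a quarter turn is a box with its sides exchanged, and boxes
  determine the measure. The orbit averages in the maximum principle rest on this
  invariance.\<close>

lemma lborel_distr_mult_i: "distr lborel borel (\<lambda>h. \<i> * h) = lborel"
proof (rule lborel_eqI[symmetric])
  fix l u :: complex
  assume "\<And>b. b \<in> Basis \<Longrightarrow> l \<bullet> b \<le> u \<bullet> b"
  then have le: "Re l \<le> Re u" "Im l \<le> Im u"
    by (force simp: Basis_complex_def inner_complex_def)+
  have "emeasure (distr lborel borel (\<lambda>h. \<i> * h)) (box l u) = emeasure lborel ((\<lambda>h. \<i> * h) -` box l u \<inter> space lborel)"
    by (intro emeasure_distr) (auto intro!: borel_measurable_continuous_onI continuous_intros)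
  also have "(\<lambda>h. \<i> * h) -` box l u \<inter> space lborel = box (Complex (Im l) (- Re u)) (Complex (Im u) (- Re l))"
    by (auto simp: box_def Basis_complex_def inner_complex_def)
  also have "emeasure lborel \<dots> = (\<Prod>b\<in>Basis. (u - l) \<bullet> b)"
    using le by (subst emeasure_lborel_box) (auto simp: Basis_complex_def inner_complex_def mult.commute)
  finally show "emeasure (distr lborel borel (\<lambda>h. \<i> * h)) (box l u) = (\<Prod>b\<in>Basis. (u - l) \<bullet> b)" .
qed simp

lemma has_bochner_integral_mult_i:
  fixes f :: "complex \<Rightarrow> real"
  assumes "has_bochner_integral lborel f x"
  shows "has_bochner_integral lborel (\<lambda>h. f (\<i> * h)) x"
proof -
  have [measurable]: "f \<in> borel_measurable borel"
    using assms by (auto simp: has_bochner_integral_iff)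
  have [measurable]: "(*) \<i> \<in> lborel \<rightarrow>\<^sub>M borel"
    by (auto intro!: borel_measurable_continuous_onI continuous_intros)
  show ?thesis
    using assms integrable_distr_eq[of "(*) \<i>" lborel borel f] integral_distr[of "(*) \<i>" lborel borel f]
    by (simp add: has_bochner_integral_iff lborel_distr_mult_i)
qed

lemma has_bochner_integral_translation:
  fixes f :: "complex \<Rightarrow> real"
  assumes "has_bochner_integral lborel f x"
  shows "has_bochner_integral lborel (\<lambda>h. f (c + h)) x"
proof -
  have [measurable]: "f \<in> borel_measurable borel"
    using assms by (auto simp: has_bochner_integral_iff)
  show ?thesis
    using assms integrable_distr_eq[of "(+) c" lborel borel f] integral_distr[of "(+) c" lborel borel f]
    by (simp add: has_bochner_integral_iff lborel_distr_plus)
qed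

lemma has_bochner_integral_mollifier_translate:
  assumes "0 < \<epsilon>"
  shows "has_bochner_integral lborel (\<lambda>y. mollifier \<epsilon> (y - z)) 1"
  using has_bochner_integral_translation[of "mollifier \<epsilon>" 1 "- z"]
    integrable_mollifier[OF assms] integral_mollifier[OF assms]
  by (simp add: has_bochner_integral_iff)

section \<open>Dependence of the mollified solution on the radius\<close>

lemma integrable_mult_mollifier:
  assumes u: "set_integrable lborel (cball z (2 * \<epsilon>)) u" and "0 < \<epsilon>"
  shows "integrable lborel (\<lambda>y. u y * mollifier \<epsilon> (y - z))"
proof -
  obtain B where B: "\<And>h. mollifier \<epsilon> h \<le> B" using mollifier_bounded[OF assms(2)] by auto
  \<comment> \<open>Integrability of \<open>u\<close> is given only on this disk. Cutting off there
    does not change the product, because the mollifier vanishes outside.\<close>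
  define v where "v = (\<lambda>y. indicator (cball z (2 * \<epsilon>)) y *\<^sub>R u y)"
  have v: "integrable lborel v" using u by (simp add: v_def set_integrable_def)
  have "mollifier \<epsilon> \<in> borel_measurable borel"
    by (intro borel_measurable_continuous_onI continuous_on_mollifier)
  then have [measurable]: "(\<lambda>y. mollifier \<epsilon> (y - z)) \<in> borel_measurable borel" by measurable
  have "integrable lborel (\<lambda>y. v y * mollifier \<epsilon> (y - z))"
  proof (rule Bochner_Integration.integrable_bound)
    show "integrable lborel (\<lambda>y. B * \<bar>v y\<bar>)" using v by auto
    show "AE y in lborel. norm (v y * mollifier \<epsilon> (y - z)) \<le> norm (B * \<bar>v y\<bar>)"
    proof (rule AE_I2)
      fix y
      have "\<bar>v y\<bar> * mollifier \<epsilon> (y - z) \<le> \<bar>v y\<bar> * B" by (intro mult_left_mono B) auto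
      then show "norm (v y * mollifier \<epsilon> (y - z)) \<le> norm (B * \<bar>v y\<bar>)"
        using mollifier_nonneg[of \<epsilon> "y - z"] B[of "y - z"] by (simp add: abs_mult mult.commute)
    qed
  qed (use borel_measurable_integrable[OF v] in measurable)
  also have "(\<lambda>y. v y * mollifier \<epsilon> (y - z)) = (\<lambda>y. u y * mollifier \<epsilon> (y - z))"
  proof
    fix y
    show "v y * mollifier \<epsilon> (y - z) = u y * mollifier \<epsilon> (y - z)"
      using mollifier_eq_0[OF assms(2), of "y - z"]
      by (cases "norm (y - z) \<le> 2 * \<epsilon>") (auto simp: v_def dist_norm norm_minus_commute)
  qed
  finally show ?thesis .
qed

lemma mollified_minus_log_independent:
  assumes sol: "solves_dirichlet_delta \<Omega> \<zeta> u"
    and \<epsilon>: "0 < \<epsilon>" "cball z (2 * \<epsilon>) \<subseteq> \<Omega>" and \<epsilon>': "0 < \<epsilon>'" "cball z (2 * \<epsilon>') \<subseteq> \<Omega>"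
  shows "(LINT y|lborel. u y * mollifier \<epsilon> (y - z)) - log_regularised \<epsilon> (\<zeta> - z) =
    (LINT y|lborel. u y * mollifier \<epsilon>' (y - z)) - log_regularised \<epsilon>' (\<zeta> - z)"
proof -
  have set_int: "set_integrable lborel S u" if "compact S" "S \<subseteq> \<Omega>" for S
    using sol that by (auto simp: solves_dirichlet_delta_def)
  \<comment> \<open>Both terms equal the same logarithm outside the larger disk, so the difference
    has compact support in \<Omega> and is an admissible test function. Its value at \<zeta>
    produces the two \<open>log_regularised\<close> terms of the claim.\<close>
  define \<psi> where "\<psi> = (\<lambda>y. log_regularised \<epsilon> (y - z) - log_regularised \<epsilon>' (y - z))"
  have smooth: "C_k k \<psi>" for k
  proof -
    have "C_k k (\<lambda>y. log_regularised \<epsilon> (y - z) + - 1 * log_regularised \<epsilon>' (y - z))"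
      by (intro C_k_add C_k_mult C_k_const C_k_log_regularised)
    then show ?thesis by (simp add: \<psi>_def)
  qed
  have supp: "\<psi> y = 0" if "y \<notin> cball z (2 * \<epsilon>) \<union> cball z (2 * \<epsilon>')" for y
    using that \<epsilon> \<epsilon>' by (simp add: \<psi>_def log_regularised_eq_ln dist_norm norm_minus_commute)
  have "\<psi> \<in> test_functions \<Omega>"
    unfolding test_functions_def mem_Collect_eq
    by (intro conjI allI impI exI[of _ "cball z (2 * \<epsilon>) \<union> cball z (2 * \<epsilon>')"] smooth supp)
      (use \<epsilon> \<epsilon>' in auto)
  then have "\<psi> \<zeta> = - (LINT y:\<Omega>|lborel. u y * laplacian \<psi> y)"
    using sol by (simp add: solves_dirichlet_delta_def)
  also have "laplacian \<psi> = (\<lambda>y. mollifier \<epsilon>' (y - z) - mollifier \<epsilon> (y - z))"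
    unfolding \<psi>_def using laplacian_diff[OF C_k_log_regularised C_k_log_regularised]
    by (simp add: laplacian_log_regularised \<epsilon> \<epsilon>' fun_eq_iff)
  \<comment> \<open>Both mollifiers are supported in \<Omega>, so the integral over \<Omega> is one
    over the plane.\<close>
  also have "(LINT y:\<Omega>|lborel. u y * (mollifier \<epsilon>' (y - z) - mollifier \<epsilon> (y - z))) =
      (LINT y|lborel. u y * mollifier \<epsilon>' (y - z) - u y * mollifier \<epsilon> (y - z))"
    unfolding set_lebesgue_integral_def
  proof (rule Bochner_Integration.integral_cong)
    fix y
    have "mollifier \<epsilon> (y - z) = 0" "mollifier \<epsilon>' (y - z) = 0" if "y \<notin> \<Omega>"
      using that \<epsilon> \<epsilon>' by (auto intro!: mollifier_eq_0 simp: subset_eq dist_norm norm_minus_commute not_le)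
    then show "indicator \<Omega> y *\<^sub>R (u y * (mollifier \<epsilon>' (y - z) - mollifier \<epsilon> (y - z))) =
        u y * mollifier \<epsilon>' (y - z) - u y * mollifier \<epsilon> (y - z)"
      by (cases "y \<in> \<Omega>") (auto simp: algebra_simps)
  qed simp
  also have "\<dots> = (LINT y|lborel. u y * mollifier \<epsilon>' (y - z)) - (LINT y|lborel. u y * mollifier \<epsilon> (y - z))"
    using \<epsilon> \<epsilon>' by (intro Bochner_Integration.integral_diff integrable_mult_mollifier set_int) auto
  finally show ?thesis by (simp add: \<psi>_def)
qed

lemma mollified_tendsto:
  assumes u: "set_integrable lborel (cball z r) u" "0 < r" and cont: "isCont u z"
  shows "((\<lambda>\<epsilon>. LINT y|lborel. u y * mollifier \<epsilon> (y - z)) \<longlongrightarrow> u z) (at_right 0)"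
proof (rule tendstoI)
  fix e :: real assume "0 < e"
  \<comment> \<open>Half of \<open>e\<close> is reserved because averaging only yields a non-strict
    bound.\<close>
  then obtain d where d: "0 < d" "\<And>y. dist y z < d \<Longrightarrow> dist (u y) (u z) < e / 2"
    using cont unfolding continuous_at_eps_delta by (metis half_gt_zero dist_commute)
  have "dist (LINT y|lborel. u y * mollifier \<epsilon> (y - z)) (u z) < e" if \<epsilon>: "0 < \<epsilon>" "\<epsilon> < min d r / 2" for \<epsilon>
  proof -
    have "set_integrable lborel (cball z (2 * \<epsilon>)) u"
      using \<epsilon> by (intro set_integrable_subset[OF u(1)]) auto
    then have int: "integrable lborel (\<lambda>y. u y * mollifier \<epsilon> (y - z))"
      using \<epsilon> by (intro integrable_mult_mollifier)
    have m: "integrable lborel (\<lambda>y. c * mollifier \<epsilon> (y - z))" "(LINT y|lborel. c * mollifier \<epsilon> (y - z)) = c" for c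
      using has_bochner_integral_mollifier_translate[OF \<epsilon>(1), of z]
      by (auto simp: has_bochner_integral_iff)
    have "(LINT y|lborel. u y * mollifier \<epsilon> (y - z)) - u z =
        (LINT y|lborel. u y * mollifier \<epsilon> (y - z) - u z * mollifier \<epsilon> (y - z))"
      using int m by simp
    also have "norm \<dots> \<le> (LINT y|lborel. e / 2 * mollifier \<epsilon> (y - z))"
    proof (rule Bochner_Integration.integral_norm_bound_integral)
      fix y
      show "norm (u y * mollifier \<epsilon> (y - z) - u z * mollifier \<epsilon> (y - z)) \<le> e / 2 * mollifier \<epsilon> (y - z)"
      proof (cases "dist y z < d")
        case True
        then have "\<bar>u y - u z\<bar> \<le> e / 2" using d(2) by (force simp: dist_norm)
        then have "\<bar>u y - u z\<bar> * mollifier \<epsilon> (y - z) \<le> e / 2 * mollifier \<epsilon> (y - z)"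
          by (intro mult_right_mono mollifier_nonneg)
        then show ?thesis using mollifier_nonneg[of \<epsilon> "y - z"]
          by (simp add: abs_mult flip: left_diff_distrib)
      next
        case False
        then have "mollifier \<epsilon> (y - z) = 0"
          using \<epsilon> by (intro mollifier_eq_0) (auto simp: dist_norm)
        then show ?thesis by simp
      qed
    qed (use int m in auto)
    also have "\<dots> = e / 2" by (rule m)
    finally show ?thesis using \<open>0 < e\<close> by (simp add: dist_norm)
  qed
  moreover have "0 < min d r / 2" using d u by simp
  ultimately show "\<forall>\<^sub>F \<epsilon> in at_right 0. dist (LINT y|lborel. u y * mollifier \<epsilon> (y - z)) (u z) < e"
    unfolding eventually_at_right_field by blast
qed

text \<open>Keep one radius fixed and let the other tend to 0. Its mollification tends to
  \<open>u z\<close> by continuity off the pole, and its regularised logarithm eventually equals the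
  true one at \<zeta>.\<close>

lemma mollified_representation:
  assumes sol: "solves_dirichlet_delta \<Omega> \<zeta> u" and "open \<Omega>"
    and "z \<noteq> \<zeta>" "0 < \<epsilon>" "cball z (2 * \<epsilon>) \<subseteq> \<Omega>"
  shows "u z + ln (norm (\<zeta> - z)) / (2 * pi) =
    (LINT y|lborel. u y * mollifier \<epsilon> (y - z)) - log_regularised \<epsilon> (\<zeta> - z)" (is "_ = ?D")
proof -
  have "z \<in> \<Omega>" using assms by (metis centre_in_cball less_imp_le mult_pos_pos subsetD zero_less_numeral)
  have "set_integrable lborel (cball z (2 * \<epsilon>)) u"
    using sol assms by (auto simp: solves_dirichlet_delta_def)
  moreover have "isCont u z"
  proof -
    have "continuous_on (\<Omega> - {\<zeta>}) u"
      using sol closure_subset by (auto simp: solves_dirichlet_delta_def intro: continuous_on_subset)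
    then show ?thesis
      using assms \<open>z \<in> \<Omega>\<close> by (subst (asm) continuous_on_eq_continuous_at) auto
  qed
  ultimately have "((\<lambda>\<epsilon>. LINT y|lborel. u y * mollifier \<epsilon> (y - z)) \<longlongrightarrow> u z) (at_right 0)"
    using assms by (intro mollified_tendsto[of z "2 * \<epsilon>"]) auto
  moreover have "\<forall>\<^sub>F \<epsilon>' in at_right 0. (LINT y|lborel. u y * mollifier \<epsilon>' (y - z)) = ?D - ln (norm (\<zeta> - z)) / (2 * pi)"
  proof -
    have "(LINT y|lborel. u y * mollifier \<epsilon>' (y - z)) = ?D - ln (norm (\<zeta> - z)) / (2 * pi)"
      if \<epsilon>': "0 < \<epsilon>'" "\<epsilon>' < min \<epsilon> (norm (\<zeta> - z) / 2)" for \<epsilon>'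
    proof -
      have "cball z (2 * \<epsilon>') \<subseteq> \<Omega>" using assms(5) \<epsilon>' by (auto simp: subset_eq)
      then show ?thesis
        using mollified_minus_log_independent[OF sol assms(4,5) \<epsilon>'(1)] \<epsilon>'
        by (simp add: log_regularised_eq_ln)
    qed
    moreover have "0 < min \<epsilon> (norm (\<zeta> - z) / 2)" using assms by simp
    ultimately show ?thesis unfolding eventually_at_right_field by blast
  qed
  ultimately have "((\<lambda>\<epsilon>. ?D - ln (norm (\<zeta> - z)) / (2 * pi)) \<longlongrightarrow> u z) (at_right (0::real))"
    by (rule Lim_transform_eventually)
  then have "?D - ln (norm (\<zeta> - z)) / (2 * pi) = u z"
    by (simp add: tendsto_const_iff)
  then show ?thesis by simp
qed

text \<open>In \<open>mollified_representation\<close> one radius serves all points near \<zeta>,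
  and then the right side is bounded above uniformly in these points.\<close>

lemma bounded_above_near_pole:
  assumes sol: "solves_dirichlet_delta \<Omega> \<zeta> u" and "open \<Omega>" "\<zeta> \<in> \<Omega>"
  shows "\<exists>r>0. \<exists>B. \<forall>z. z \<noteq> \<zeta> \<longrightarrow> norm (\<zeta> - z) < r \<longrightarrow> u z \<le> B - ln (norm (\<zeta> - z)) / (2 * pi)"
proof -
  obtain e where e: "0 < e" "cball \<zeta> e \<subseteq> \<Omega>"
    using assms(2,3) unfolding open_contains_cball by blast
  \<comment> \<open>With this radius, the disks of radius 2 \<epsilon> about points within
    \<epsilon> of the pole stay in the disk of radius 4 \<epsilon> about the pole.\<close>
  define \<epsilon> where "\<epsilon> = e / 4"
  have \<epsilon>: "0 < \<epsilon>" "cball \<zeta> (4 * \<epsilon>) \<subseteq> \<Omega>" using e by (auto simp: \<epsilon>_def)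
  obtain b where b: "\<And>h. mollifier \<epsilon> h \<le> b" using mollifier_bounded[OF \<epsilon>(1)] by auto
  have cont: "continuous_on UNIV (log_regularised \<epsilon>)"
    using C_k_log_regularised[of 0 \<epsilon> 0] by simp
  have "compact (log_regularised \<epsilon> ` cball 0 \<epsilon>)"
    by (intro compact_continuous_image continuous_on_subset[OF cont]) auto
  then obtain c where c: "\<And>h. norm h \<le> \<epsilon> \<Longrightarrow> \<bar>log_regularised \<epsilon> h\<bar> \<le> c"
    by (force dest!: compact_imp_bounded simp: bounded_iff)
  \<comment> \<open>Restricting \<open>u\<close> to one fixed disk yields the majorant
    \<open>\<bar>v y\<bar> * b\<close>, whose integral does not depend on \<open>z\<close>.\<close>
  define v where "v = (\<lambda>y. indicator (cball \<zeta> (4 * \<epsilon>)) y *\<^sub>R u y)"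
  have v: "integrable lborel v"
    using sol \<epsilon> by (auto simp: v_def solves_dirichlet_delta_def set_integrable_def)
  show ?thesis
  proof (intro exI conjI allI impI)
    fix z assume z: "z \<noteq> \<zeta>" "norm (\<zeta> - z) < \<epsilon>"
    have sub: "cball z (2 * \<epsilon>) \<subseteq> cball \<zeta> (4 * \<epsilon>)"
    proof
      fix y assume "y \<in> cball z (2 * \<epsilon>)"
      then show "y \<in> cball \<zeta> (4 * \<epsilon>)"
        using dist_triangle[of \<zeta> y z] z \<epsilon>(1) by (simp add: dist_norm)
    qed
    then have cb: "cball z (2 * \<epsilon>) \<subseteq> \<Omega>" using \<epsilon> by auto
    have "(LINT y|lborel. u y * mollifier \<epsilon> (y - z)) \<le> (LINT y|lborel. \<bar>v y\<bar> * b)"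
    proof (rule Bochner_Integration.integral_mono)
      show "integrable lborel (\<lambda>y. u y * mollifier \<epsilon> (y - z))"
        using sol cb \<epsilon> by (intro integrable_mult_mollifier) (auto simp: solves_dirichlet_delta_def)
      show "integrable lborel (\<lambda>y. \<bar>v y\<bar> * b)" using v by auto
      fix y
      show "u y * mollifier \<epsilon> (y - z) \<le> \<bar>v y\<bar> * b"
      proof (cases "y \<in> cball z (2 * \<epsilon>)")
        case True
        then have uv: "u y = v y" using sub by (auto simp: v_def)
        have "u y * mollifier \<epsilon> (y - z) \<le> \<bar>u y\<bar> * mollifier \<epsilon> (y - z)"
          by (intro mult_right_mono mollifier_nonneg) auto
        also have "\<dots> \<le> \<bar>u y\<bar> * b" by (intro mult_left_mono b) auto
        finally show ?thesis by (simp add: uv)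
      next
        case False
        then have "mollifier \<epsilon> (y - z) = 0"
          using \<epsilon> by (intro mollifier_eq_0) (auto simp: dist_norm norm_minus_commute)
        moreover have "0 \<le> b" using b mollifier_nonneg order_trans by blast
        ultimately show ?thesis by simp
      qed
    qed
    moreover have "- log_regularised \<epsilon> (\<zeta> - z) \<le> c" using c[of "\<zeta> - z"] z by simp
    ultimately show "u z \<le> ((LINT y|lborel. \<bar>v y\<bar> * b) + c) - ln (norm (\<zeta> - z)) / (2 * pi)"
      using mollified_representation[OF sol assms(2) z(1) \<epsilon>(1) cb] by linarith
  qed (rule \<epsilon>)
qed

text \<open>Since the pole is at distance at least 2 \<epsilon>, the regularised logarithm is exact
  there and the logarithms in \<open>mollified_representation\<close> cancel. Subtracting
  \<open>u z\<close> uses that the mollifier has mass 1.\<close>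

lemma weak_mean_value:
  assumes "solves_dirichlet_delta \<Omega> \<zeta> u" "open \<Omega>"
    and "0 < \<epsilon>" "2 * \<epsilon> \<le> norm (\<zeta> - z)" "cball z (2 * \<epsilon>) \<subseteq> \<Omega>"
  shows "has_bochner_integral lborel (\<lambda>h. (u (z + h) - u z) * mollifier \<epsilon> h) 0"
proof -
  have "z \<noteq> \<zeta>" using assms by auto
  have "(LINT y|lborel. u y * mollifier \<epsilon> (y - z)) = u z"
    using mollified_representation[OF assms(1,2) \<open>z \<noteq> \<zeta>\<close> assms(3,5)] assms
    by (simp add: log_regularised_eq_ln)
  moreover have "integrable lborel (\<lambda>y. u y * mollifier \<epsilon> (y - z))"
    using assms by (intro integrable_mult_mollifier) (auto simp: solves_dirichlet_delta_def)
  ultimately have "has_bochner_integral lborel (\<lambda>y. u y * mollifier \<epsilon> (y - z)) (u z)"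
    by (simp add: has_bochner_integral_iff)
  from has_bochner_integral_translation[OF this, of z]
  have "has_bochner_integral lborel (\<lambda>h. u (z + h) * mollifier \<epsilon> h) (u z)" by simp
  moreover have "has_bochner_integral lborel (\<lambda>h. u z * mollifier \<epsilon> h) (u z * 1)"
    using integrable_mollifier[OF assms(3)] integral_mollifier[OF assms(3)]
    by (simp add: has_bochner_integral_iff)
  ultimately have "has_bochner_integral lborel (\<lambda>h. u (z + h) * mollifier \<epsilon> h - u z * mollifier \<epsilon> h) (u z - u z * 1)"
    by (rule has_bochner_integral_diff)
  then show ?thesis by (simp add: left_diff_distrib)
qed

subsection \<open>The maximum principle\<close>

text \<open>Averaging over a quarter-turn orbit replaces the mean value property of \<open>ln \<bar>\<cdot>\<bar>\<close>: the four
  factors multiply to \<open>b\<^sup>4 - h\<^sup>4\<close>, so the error is of fourth order.\<close>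

lemma sum_ln_norm_quarter_turns:
  fixes b h :: complex
  assumes "norm h < norm b"
  shows "ln (norm (b + h)) + ln (norm (b + \<i> * h)) + ln (norm (b + \<i> * (\<i> * h))) + ln (norm (b + \<i> * (\<i> * (\<i> * h))))
    = 4 * ln (norm b) + ln (norm (1 - (h / b) ^ 4))"
proof -
  have pos: "0 < norm (b + k)" if "norm k = norm h" for k
  proof -
    have "b + k \<noteq> 0"
    proof
      assume "b + k = 0"
      then have "k = - b" by (simp add: add_eq_0_iff)
      then show False using assms that by simp
    qed
    then show ?thesis by simp
  qed
  have "b \<noteq> 0" using assms by auto
  have "(h / b) ^ 4 \<noteq> 1"
  proof
    assume "(h / b) ^ 4 = 1"
    then have "norm (h / b) ^ 4 = 1" by (metis norm_power norm_one)
    moreover have "norm (h / b) ^ 4 < 1"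
      using assms \<open>b \<noteq> 0\<close> by (intro power_less_one_iff[THEN iffD2]) (auto simp: norm_divide)
    ultimately show False by simp
  qed
  have "ln (norm (b + h)) + ln (norm (b + \<i> * h)) + ln (norm (b + \<i> * (\<i> * h))) + ln (norm (b + \<i> * (\<i> * (\<i> * h))))
    = ln (norm (b + h) * norm (b + \<i> * h) * norm (b + \<i> * (\<i> * h)) * norm (b + \<i> * (\<i> * (\<i> * h))))"
    using pos[of h] pos[of "\<i> * h"] pos[of "\<i> * (\<i> * h)"] pos[of "\<i> * (\<i> * (\<i> * h))"]
    by (simp add: ln_mult norm_mult del: i_times_eq_iff)
  also have "norm (b + h) * norm (b + \<i> * h) * norm (b + \<i> * (\<i> * h)) * norm (b + \<i> * (\<i> * (\<i> * h)))
    = norm ((b + h) * (b + \<i> * h) * (b + \<i> * (\<i> * h)) * (b + \<i> * (\<i> * (\<i> * h))))"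
    by (simp only: norm_mult)
  also have "(b + h) * (b + \<i> * h) * (b + \<i> * (\<i> * h)) * (b + \<i> * (\<i> * (\<i> * h))) = b ^ 4 * (1 - (h / b) ^ 4)"
  proof -
    have "(b + h) * (b + \<i> * h) * (b + \<i> * (\<i> * h)) * (b + \<i> * (\<i> * (\<i> * h))) = b ^ 4 - h ^ 4"
    proof -
      have "(b + h) * (b + \<i> * h) * (b + - h) * (b + - (\<i> * h)) = ((b + h) * (b + - h)) * ((b + \<i> * h) * (b + - (\<i> * h)))"
        by (simp only: ac_simps)
      also have "\<dots> = (b\<^sup>2 - h\<^sup>2) * (b\<^sup>2 - (\<i> * h)\<^sup>2)"
        by (simp add: power2_eq_square square_diff_square_factored)
      also have "\<dots> = (b\<^sup>2 - h\<^sup>2) * (b\<^sup>2 + h\<^sup>2)" by (simp add: power_mult_distrib)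
      also have "\<dots> = b ^ 4 - h ^ 4" by (simp add: algebra_simps power2_eq_square power4_eq_xxxx)
      finally show ?thesis by simp
    qed
    also have "\<dots> = b ^ 4 * (1 - (h / b) ^ 4)" using \<open>b \<noteq> 0\<close> by (simp add: field_simps)
    finally show ?thesis .
  qed
  also have "ln (norm \<dots>) = 4 * ln (norm b) + ln (norm (1 - (h / b) ^ 4))"
    using \<open>b \<noteq> 0\<close> \<open>(h / b) ^ 4 \<noteq> 1\<close> by (simp add: norm_mult norm_power ln_mult ln_realpow)
  finally show ?thesis .
qed

text \<open>The mixed terms cancel along the orbit. The surplus of second order in \<open>h\<close>
  is what dominates the fourth-order error of the logarithm.\<close>

lemma sum_norm_square_quarter_turns:
  fixes b h :: complex
  shows "(norm (b + h))\<^sup>2 + (norm (b + \<i> * h))\<^sup>2 + (norm (b + \<i> * (\<i> * h)))\<^sup>2 + (norm (b + \<i> * (\<i> * (\<i> * h))))\<^sup>2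
    = 4 * (norm b)\<^sup>2 + 4 * (norm h)\<^sup>2"
  unfolding cmod_power2 by (simp add: power2_eq_square algebra_simps)

lemma abs_ln_norm_one_minus_le:
  fixes w :: complex
  assumes "norm w \<le> 1 / 2"
  shows "\<bar>ln (norm (1 - w))\<bar> \<le> 2 * norm w"
proof -
  have "\<bar>norm (1 - w) - 1\<bar> \<le> norm w" using norm_triangle_ineq3[of "1 - w" 1] by simp
  then have n: "1 - norm w \<le> norm (1 - w)" "norm (1 - w) \<le> 1 + norm w" by auto
  have "ln (norm (1 - w)) \<le> norm (1 - w) - 1" using n assms by (intro ln_le_minus_one) linarith
  moreover have "- (2 * norm w) \<le> ln (norm (1 - w))"
  proof -
    \<comment> \<open>For \<open>norm w \<le> 1 / 2\<close> the quadratic term costs at most one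
      more \<open>norm w\<close>.\<close>
    have "- norm w - 2 * (norm w)\<^sup>2 \<le> ln (1 - norm w)" using assms by (intro ln_one_minus_pos_lower_bound) auto
    moreover have "norm w * norm w \<le> norm w * (1 / 2)" using assms by (intro mult_left_mono) auto
    moreover have "ln (1 - norm w) \<le> ln (norm (1 - w))" using n assms by (intro ln_mono) auto
    ultimately show ?thesis by (simp add: power2_eq_square)
  qed
  ultimately show ?thesis using n by simp
qed

text \<open>The quadratic term makes \<open>u + G\<close> strictly subharmonic off the pole,
  whatever the sign of \<open>a\<close>. At a local maximum, averaging over quarter turns and
  integrating against the mollifier would bound 0 by
  \<open>- 2 * \<kappa> * \<epsilon>\<^sup>2\<close>.\<close>

lemma no_interior_maximum:
  fixes a :: real
  assumes sol: "solves_dirichlet_delta \<Omega> \<zeta> u" "open \<Omega>"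
    and z: "z \<in> \<Omega>" "z \<noteq> \<zeta>" and "0 < r" "0 < \<kappa>"
  defines "G \<equiv> \<lambda>y. a * ln (norm (y - \<zeta>)) + \<kappa> * (norm (y - \<zeta>))\<^sup>2"
  shows "\<exists>y \<in> ball z r. u z + G z < u y + G y"
proof (rule ccontr)
  assume "\<not> ?thesis"
  then have max: "u y - u z \<le> G z - G y" if "y \<in> ball z r" for y using that by force
  define b where "b = z - \<zeta>"
  have b: "0 < norm b" using z by (simp add: b_def)
  obtain e where e: "0 < e" "cball z e \<subseteq> \<Omega>"
    using sol(2) z(1) unfolding open_contains_cball by blast
  \<comment> \<open>The bounds \<open>r\<close> and \<open>e\<close> keep the orbit in the ball and
    in \<Omega>, and \<open>norm b / 2\<close> keeps it off the pole with |h / b| at most 1/2. The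
    bound 1 and the last quotient give |a| |h / b|^4 \<le> \<kappa> |h|^2; adding 1 to |a| covers
    \<open>a = 0\<close>.\<close>
  define d where "d = min (min r e) (min (min 1 (norm b / 2)) (\<kappa> * norm b ^ 4 / (\<bar>a\<bar> + 1)))"
  define \<epsilon> where "\<epsilon> = d / 4"
  have "0 < d" using assms b e by (auto simp: d_def)
  then have \<epsilon>: "0 < \<epsilon>" "2 * \<epsilon> < d" by (auto simp: \<epsilon>_def)
  have f: "has_bochner_integral lborel (\<lambda>h. (u (z + h) - u z) * mollifier \<epsilon> h) 0"
  proof (rule weak_mean_value[OF sol \<epsilon>(1)])
    show "2 * \<epsilon> \<le> norm (\<zeta> - z)" using \<epsilon> b by (simp add: d_def b_def norm_minus_commute)
    show "cball z (2 * \<epsilon>) \<subseteq> \<Omega>" using \<epsilon> e by (auto simp: d_def)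
  qed
  \<comment> \<open>The mean value integrand summed over a quarter-turn orbit; rotation invariance
    makes each of the four integrals 0.\<close>
  define F where "F h = (u (z + h) - u z) * mollifier \<epsilon> h + (u (z + \<i> * h) - u z) * mollifier \<epsilon> (\<i> * h)
    + (u (z + \<i> * (\<i> * h)) - u z) * mollifier \<epsilon> (\<i> * (\<i> * h))
    + (u (z + \<i> * (\<i> * (\<i> * h))) - u z) * mollifier \<epsilon> (\<i> * (\<i> * (\<i> * h)))" for h
  note f1 = has_bochner_integral_mult_i[OF f]
  note f2 = has_bochner_integral_mult_i[OF f1]
  note f3 = has_bochner_integral_mult_i[OF f2]
  have F: "has_bochner_integral lborel F (0 + 0 + 0 + 0)"
    unfolding F_def by (intro has_bochner_integral_add f f1 f2 f3)
  have "F h \<le> (- 2 * \<kappa> * \<epsilon>\<^sup>2) * mollifier \<epsilon> h" for h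
  proof (cases "norm h < \<epsilon> \<or> 2 * \<epsilon> < norm h")
    case True
    then have "mollifier \<epsilon> k = 0" if "norm k = norm h" for k
      using mollifier_eq_0[OF \<epsilon>(1), of k] that by simp
    then show ?thesis by (simp add: F_def norm_mult)
  next
    case False
    then have h: "\<epsilon> \<le> norm h" "norm h < d" using \<epsilon> by auto
    then have hd: "norm h < r" "norm h < 1" "norm h < norm b / 2" "norm h < \<kappa> * norm b ^ 4 / (\<bar>a\<bar> + 1)"
      by (auto simp: d_def)
    define w where "w = (h / b) ^ 4"
    have "norm (h / b) \<le> 1 / 2" using hd b by (simp add: norm_divide field_simps)
    then have "norm (h / b) ^ 4 \<le> (1 / 2) ^ 4" by (intro power_mono) auto
    then have w: "norm w \<le> 1 / 2" by (simp add: w_def norm_power power_one_over)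
    have "\<bar>a\<bar> * norm w \<le> \<kappa> * (norm h)\<^sup>2"
    proof -
      have "(norm h)\<^sup>2 \<le> norm h"
        using hd mult_left_mono[of "norm h" 1 "norm h"] by (simp add: power2_eq_square)
      then have "\<bar>a\<bar> * (norm h)\<^sup>2 \<le> (\<bar>a\<bar> + 1) * norm h" by (intro mult_mono) auto
      also have "\<dots> \<le> \<kappa> * norm b ^ 4"
        using hd(4) pos_less_divide_eq[of "\<bar>a\<bar> + 1"] by (simp add: mult.commute)
      finally have "\<bar>a\<bar> * (norm h)\<^sup>2 \<le> \<kappa> * norm b ^ 4" .
      then have "\<bar>a\<bar> * (norm h)\<^sup>2 * (norm h)\<^sup>2 \<le> \<kappa> * norm b ^ 4 * (norm h)\<^sup>2"
        by (intro mult_right_mono) auto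
      then have "\<bar>a\<bar> * norm h ^ 4 \<le> \<kappa> * (norm h)\<^sup>2 * norm b ^ 4"
        by (simp add: ac_simps power4_eq_xxxx power2_eq_square)
      then show ?thesis using b by (simp add: w_def norm_power norm_divide power_divide divide_le_eq)
    qed
    moreover have "\<bar>a * ln (norm (1 - w))\<bar> \<le> \<bar>a\<bar> * (2 * norm w)"
      unfolding abs_mult by (intro mult_left_mono abs_ln_norm_one_minus_le w) auto
    \<comment> \<open>The logarithmic error uses up at most half of the surplus
      \<open>4 * \<kappa> * (norm h)\<^sup>2\<close>.\<close>
    ultimately have a: "- (2 * \<kappa> * (norm h)\<^sup>2) \<le> a * ln (norm (1 - w))" by linarith
    have "norm h < norm b" using hd b by linarith
    have Gk: "G (z + k) = a * ln (norm (b + k)) + \<kappa> * (norm (b + k))\<^sup>2" for k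
      by (simp add: G_def b_def algebra_simps)
    have "G (z + h) + G (z + \<i> * h) + G (z + \<i> * (\<i> * h)) + G (z + \<i> * (\<i> * (\<i> * h)))
      = a * (ln (norm (b + h)) + ln (norm (b + \<i> * h)) + ln (norm (b + \<i> * (\<i> * h))) + ln (norm (b + \<i> * (\<i> * (\<i> * h)))))
      + \<kappa> * ((norm (b + h))\<^sup>2 + (norm (b + \<i> * h))\<^sup>2 + (norm (b + \<i> * (\<i> * h)))\<^sup>2 + (norm (b + \<i> * (\<i> * (\<i> * h))))\<^sup>2)"
      unfolding Gk distrib_left by (simp only: ac_simps)
    also have "\<dots> = a * (4 * ln (norm b) + ln (norm (1 - w))) + \<kappa> * (4 * (norm b)\<^sup>2 + 4 * (norm h)\<^sup>2)"
      unfolding sum_ln_norm_quarter_turns[OF \<open>norm h < norm b\<close>] sum_norm_square_quarter_turns w_def ..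
    also have "\<dots> = 4 * G z + a * ln (norm (1 - w)) + 4 * \<kappa> * (norm h)\<^sup>2"
      by (simp add: G_def b_def algebra_simps)
    finally have Gsum: "4 * G z + 2 * \<kappa> * (norm h)\<^sup>2 \<le>
        G (z + h) + G (z + \<i> * h) + G (z + \<i> * (\<i> * h)) + G (z + \<i> * (\<i> * (\<i> * h)))"
      using a by linarith
    have "u (z + k) - u z \<le> G z - G (z + k)" if "norm k = norm h" for k
      using max[of "z + k"] that hd by (simp add: dist_norm)
    from this[of h] this[of "\<i> * h"] this[of "\<i> * (\<i> * h)"] this[of "\<i> * (\<i> * (\<i> * h))"]
    have "(u (z + h) - u z) + (u (z + \<i> * h) - u z) + (u (z + \<i> * (\<i> * h)) - u z) + (u (z + \<i> * (\<i> * (\<i> * h))) - u z)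
        \<le> - (2 * \<kappa> * (norm h)\<^sup>2)" (is "?S \<le> _")
      using Gsum unfolding norm_mult norm_ii mult_1 by linarith
    \<comment> \<open>On the remaining annulus \<open>\<epsilon> \<le> norm h\<close>, which makes
      the gap independent of \<open>h\<close>.\<close>
    also have "\<dots> \<le> - (2 * \<kappa> * \<epsilon>\<^sup>2)"
      using h \<epsilon> assms by (auto intro!: mult_left_mono power_mono)
    finally have "?S * mollifier \<epsilon> h \<le> - (2 * \<kappa> * \<epsilon>\<^sup>2) * mollifier \<epsilon> h"
      by (intro mult_right_mono mollifier_nonneg)
    moreover have "F h = ?S * mollifier \<epsilon> h"
    proof -
      have "mollifier \<epsilon> (\<i> * k) = mollifier \<epsilon> k" for k by (simp add: mollifier_def norm_mult)
      then show ?thesis unfolding F_def distrib_right by presburger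
    qed
    ultimately show ?thesis by simp
  qed
  then have "(LINT h|lborel. F h) \<le> (LINT h|lborel. (- 2 * \<kappa> * \<epsilon>\<^sup>2) * mollifier \<epsilon> h)"
    using F integrable_mollifier[OF \<epsilon>(1)]
    by (intro Bochner_Integration.integral_mono) (auto simp: has_bochner_integral_iff)
  also have "\<dots> = - 2 * \<kappa> * \<epsilon>\<^sup>2"
    using integral_mollifier[OF \<epsilon>(1)] by simp
  also have "\<dots> < 0" using assms \<epsilon> by simp
  finally show False using F by (simp add: has_bochner_integral_iff)
qed

section \<open>Comparison with the Green's function of the enclosing disk\<close>

lemma greens_function_le_log:
  assumes sol: "solves_dirichlet_delta \<Omega> \<zeta> u" and "open \<Omega>" "\<zeta> \<in> \<Omega>" and R: "\<Omega> \<subseteq> ball \<zeta> R"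
    and z: "z \<in> \<Omega>" "z \<noteq> \<zeta>"
  shows "u z \<le> (ln R - ln (norm (z - \<zeta>))) / (2 * pi)"
proof -
  have bdry: "u y = 0" if "y \<in> frontier \<Omega>" for y
    using sol that by (auto simp: solves_dirichlet_delta_def)
  have contu: "continuous_on (closure \<Omega> - {\<zeta>}) u"
    using sol by (simp add: solves_dirichlet_delta_def)
  have "closure \<Omega> \<subseteq> cball \<zeta> R"
    using R by (intro closure_minimal) auto
  then have clR: "norm (y - \<zeta>) \<le> R" if "y \<in> closure \<Omega>" for y
    using that by (auto simp: dist_norm norm_minus_commute)
  have "0 < R" using R \<open>\<zeta> \<in> \<Omega>\<close> by force
  \<comment> \<open>The comparison is perturbed by \<tau>: the enlarged coefficient of the logarithm
    outweighs the bounded error in the estimate near the pole, and the quadratic term gives strict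
    subharmonicity. Both corrections are nonpositive on the closure of \<Omega> off the pole and
    disappear as \<tau> tends to 0.\<close>
  have le: "u z + (1 + \<tau>) / (2 * pi) * (ln (norm (z - \<zeta>)) - ln R) + \<tau> * ((norm (z - \<zeta>))\<^sup>2 - R\<^sup>2) \<le> 0"
    if "0 < \<tau>" for \<tau>
  proof (rule ccontr)
    define g where "g y = u y + (1 + \<tau>) / (2 * pi) * (ln (norm (y - \<zeta>)) - ln R) + \<tau> * ((norm (y - \<zeta>))\<^sup>2 - R\<^sup>2)" for y
    assume "\<not> ?thesis"
    then have gz: "0 < g z" by (simp add: g_def)
    have ln_le: "ln (norm (y - \<zeta>)) \<le> ln R" and sq_le: "(norm (y - \<zeta>))\<^sup>2 \<le> R\<^sup>2"
      if "y \<in> closure \<Omega>" "y \<noteq> \<zeta>" for y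
      using clR[OF that(1)] that(2) \<open>0 < R\<close> by (auto intro!: power_mono)
    obtain r B where r: "0 < r"
      "\<And>y. y \<noteq> \<zeta> \<Longrightarrow> norm (\<zeta> - y) < r \<Longrightarrow> u y \<le> B - ln (norm (\<zeta> - y)) / (2 * pi)"
      using bounded_above_near_pole[OF sol assms(2,3)] by blast
    define B' where "B' = B - (1 + \<tau>) / (2 * pi) * ln R"
    \<comment> \<open>Within this distance the surplus
      \<open>\<tau> / (2 * pi) * ln (norm (y - \<zeta>))\<close> is at most \<open>- B'\<close>,
      where \<open>B'\<close> collects the constants in the bound near the pole.\<close>
    define \<delta> where "\<delta> = min r (exp (- (2 * pi * B' / \<tau>)))"
    have "0 < \<delta>" using r by (simp add: \<delta>_def)
    have near: "g y \<le> 0" if y: "y \<in> closure \<Omega>" "y \<noteq> \<zeta>" "norm (y - \<zeta>) < \<delta>" for y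
    proof -
      have "ln (norm (y - \<zeta>)) < - (2 * pi * B' / \<tau>)"
      proof -
        have "ln (norm (y - \<zeta>)) < ln (exp (- (2 * pi * B' / \<tau>)))"
          using y by (subst ln_less_cancel_iff) (auto simp: \<delta>_def)
        then show ?thesis by (simp only: ln_exp)
      qed
      then have "\<tau> / (2 * pi) * ln (norm (y - \<zeta>)) \<le> \<tau> / (2 * pi) * - (2 * pi * B' / \<tau>)"
        using \<open>0 < \<tau>\<close> by (intro mult_left_mono) auto
      also have "\<dots> = - B'" using \<open>0 < \<tau>\<close> by simp
      finally have 1: "\<tau> / (2 * pi) * ln (norm (y - \<zeta>)) + B' \<le> 0" by simp
      have "u y \<le> B - ln (norm (y - \<zeta>)) / (2 * pi)"
        using r(2)[of y] y by (simp add: \<delta>_def norm_minus_commute)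
      moreover have "\<tau> * ((norm (y - \<zeta>))\<^sup>2 - R\<^sup>2) \<le> 0"
        using sq_le[OF y(1,2)] \<open>0 < \<tau>\<close> by (simp add: mult_le_0_iff)
      moreover have "B - ln (norm (y - \<zeta>)) / (2 * pi) + (1 + \<tau>) / (2 * pi) * (ln (norm (y - \<zeta>)) - ln R)
          = \<tau> / (2 * pi) * ln (norm (y - \<zeta>)) + B'"
        by (simp add: B'_def field_simps)
      ultimately show ?thesis using 1 unfolding g_def by linarith
    qed
    \<comment> \<open>Removing the disk where \<open>g\<close> is nonpositive leaves a compact set
      on which \<open>g\<close> is continuous and which still contains \<open>z\<close>, as
      \<open>g z\<close> is positive.\<close>
    define K where "K = closure \<Omega> - ball \<zeta> \<delta>"
    have "compact K"
    proof -
      have "bounded \<Omega>" using R bounded_subset bounded_ball by blast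
      then show ?thesis unfolding K_def by (intro compact_diff) (auto simp: compact_closure)
    qed
    moreover have zK: "z \<in> K"
    proof -
      have "z \<in> closure \<Omega>" using z closure_subset by auto
      then show ?thesis using near[of z] gz z by (force simp: K_def dist_norm norm_minus_commute)
    qed
    moreover have "continuous_on K g"
      unfolding g_def using \<open>0 < \<delta>\<close>
      by (intro continuous_intros continuous_on_subset[OF contu]) (auto simp: K_def)
    ultimately obtain z0 where z0: "z0 \<in> K" "\<And>y. y \<in> K \<Longrightarrow> g y \<le> g z0"
      using continuous_attains_sup[of K g] by blast
    have g0: "0 < g z0" using z0(2)[OF zK] gz by simp
    have z0c: "z0 \<in> closure \<Omega>" "z0 \<noteq> \<zeta>" using z0(1) \<open>0 < \<delta>\<close> by (auto simp: K_def)
    have "z0 \<in> \<Omega>"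
    proof (rule ccontr)
      assume "z0 \<notin> \<Omega>"
      then have "u z0 = 0"
        using z0c \<open>open \<Omega>\<close> by (intro bdry) (simp add: frontier_def interior_open)
      moreover have "(1 + \<tau>) / (2 * pi) * (ln (norm (z0 - \<zeta>)) - ln R) \<le> 0"
        using ln_le[OF z0c] \<open>0 < \<tau>\<close> by (intro mult_nonneg_nonpos) auto
      moreover have "\<tau> * ((norm (z0 - \<zeta>))\<^sup>2 - R\<^sup>2) \<le> 0"
        using sq_le[OF z0c] \<open>0 < \<tau>\<close> by (intro mult_nonneg_nonpos) auto
      ultimately show False using g0 unfolding g_def by linarith
    qed
    have "open (\<Omega> - {\<zeta>})" "z0 \<in> \<Omega> - {\<zeta>}"
      using \<open>open \<Omega>\<close> \<open>z0 \<in> \<Omega>\<close> z0c by auto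
    then obtain e where e: "0 < e" "ball z0 e \<subseteq> \<Omega> - {\<zeta>}"
      unfolding open_contains_ball by blast
    obtain y where y: "y \<in> ball z0 e"
      and lt: "u z0 + ((1 + \<tau>) / (2 * pi) * ln (norm (z0 - \<zeta>)) + \<tau> * (norm (z0 - \<zeta>))\<^sup>2)
        < u y + ((1 + \<tau>) / (2 * pi) * ln (norm (y - \<zeta>)) + \<tau> * (norm (y - \<zeta>))\<^sup>2)"
      using no_interior_maximum[OF sol \<open>open \<Omega>\<close> \<open>z0 \<in> \<Omega>\<close> z0c(2) e(1) \<open>0 < \<tau>\<close>, of "(1 + \<tau>) / (2 * pi)"]
      by blast
    have gy: "g z0 < g y" using lt unfolding g_def right_diff_distrib by linarith
    have "y \<in> \<Omega> - {\<zeta>}" using y e(2) by blast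
    then have yc: "y \<in> closure \<Omega>" "y \<noteq> \<zeta>" using closure_subset[of \<Omega>] by auto
    \<comment> \<open>The better point may fall into the removed disk, where \<open>g\<close> is
      nonpositive; otherwise it lies in \<open>K\<close> and competes with the maximum.\<close>
    have "g y \<le> 0 \<or> g y \<le> g z0"
    proof (cases "norm (y - \<zeta>) < \<delta>")
      case False
      then have "y \<in> K" using yc by (simp add: K_def dist_norm norm_minus_commute)
      then show ?thesis using z0(2) by blast
    qed (use near[OF yc] in blast)
    then show False using g0 gy by linarith
  qed
  define x where "x = u z - (ln R - ln (norm (z - \<zeta>))) / (2 * pi)"
  define c where "c = (ln R - ln (norm (z - \<zeta>))) / (2 * pi) + (R\<^sup>2 - (norm (z - \<zeta>))\<^sup>2)"
  have xc: "x \<le> \<tau> * c" if "0 < \<tau>" for \<tau>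
    using le[OF that] by (simp add: x_def c_def add_divide_distrib diff_divide_distrib algebra_simps)
  have "x \<le> 0"
  proof (rule field_le_epsilon)
    fix e :: real assume "0 < e"
    \<comment> \<open>This choice of \<tau> works for either sign of \<open>c\<close> and for
      \<open>c = 0\<close>.\<close>
    have "x \<le> e / (\<bar>c\<bar> + 1) * c" using \<open>0 < e\<close> by (intro xc) auto
    also have "\<dots> \<le> e / (\<bar>c\<bar> + 1) * (\<bar>c\<bar> + 1)" using \<open>0 < e\<close> by (intro mult_left_mono) auto
    also have "\<dots> = e" by (simp add: add_nonneg_eq_0_iff)
    finally show "x \<le> 0 + e" by simp
  qed
  then show ?thesis by (simp add: x_def)
qed

subsection \<open>Comparison at the farthest boundary point\<close>

text \<open>Moving by \<open>t\<close> along a unit vector leaves distance at least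
  \<open>R - t\<close> from \<zeta>. So the difference quotients of \<open>u\<close> stay below
  those of \<open>- ln (1 - t / R) / (2 * pi)\<close>, which also vanishes at \<open>t = 0\<close>
  and has slope \<open>1 / (2 * pi * R)\<close> there.\<close>

lemma normal_derivative_le_at_farthest_point:
  assumes sol: "solves_dirichlet_delta \<Omega> \<zeta> u" and "open \<Omega>" "\<zeta> \<in> \<Omega>" and R: "\<Omega> \<subseteq> ball \<zeta> R"
    and \<phi>: "interior_normal_derivative \<Omega> \<gamma> u \<phi>"
    and s: "\<gamma> s \<in> frontier \<Omega>" "norm (\<gamma> s - \<zeta>) = R"
  shows "\<phi> s \<le> 1 / (2 * pi * R)"
proof -
  have "0 < R" using R \<open>\<zeta> \<in> \<Omega>\<close> by force
  have "u (\<gamma> s) = 0" using sol s by (auto simp: solves_dirichlet_delta_def)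
  obtain v where v: "interior_unit_normal \<Omega> \<gamma> s v"
    and D: "((\<lambda>t. u (\<gamma> s + t *\<^sub>R v)) has_real_derivative \<phi> s) (at 0 within {0..})"
    using \<phi> by (auto simp: interior_normal_derivative_def)
  have "((\<lambda>t. u (\<gamma> s + t *\<^sub>R v)) has_real_derivative \<phi> s) (at_right 0)"
    using D by (rule DERIV_subset) auto
  then have 1: "((\<lambda>t. u (\<gamma> s + t *\<^sub>R v) / t) \<longlongrightarrow> \<phi> s) (at_right 0)"
    using \<open>u (\<gamma> s) = 0\<close> by (simp add: has_field_derivative_iff)
  have "((\<lambda>t. - ln (1 - t / R) / (2 * pi)) has_real_derivative 1 / (2 * pi * R)) (at 0)"
    using \<open>0 < R\<close> by (auto intro!: derivative_eq_intros)
  then have "((\<lambda>t. - ln (1 - t / R) / (2 * pi)) has_real_derivative 1 / (2 * pi * R)) (at_right 0)"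
    by (rule has_field_derivative_at_within)
  then have 2: "((\<lambda>t. - ln (1 - t / R) / (2 * pi) / t) \<longlongrightarrow> 1 / (2 * pi * R)) (at_right 0)"
    by (simp add: has_field_derivative_iff)
  have small: "\<forall>\<^sub>F t in at_right 0. 0 < t \<and> t < R"
    using \<open>0 < R\<close> by (auto simp: eventually_at_right_field)
  have "\<forall>\<^sub>F t in at_right 0. \<gamma> s + t *\<^sub>R v \<in> \<Omega>"
    using v by (simp add: interior_unit_normal_def)
  with small have "\<forall>\<^sub>F t in at_right 0. u (\<gamma> s + t *\<^sub>R v) / t \<le> - ln (1 - t / R) / (2 * pi) / t"
  proof eventually_elim
    case (elim t)
    let ?z = "\<gamma> s + t *\<^sub>R v"
    have "norm v = 1" using v by (simp add: interior_unit_normal_def)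
    then have n: "R - t \<le> norm (?z - \<zeta>)"
      using norm_triangle_ineq2[of "\<gamma> s - \<zeta>" "- t *\<^sub>R v"] s elim by (simp add: algebra_simps)
    then have "?z \<noteq> \<zeta>" using elim by auto
    then have "u ?z \<le> (ln R - ln (norm (?z - \<zeta>))) / (2 * pi)"
      using elim by (intro greens_function_le_log[OF sol \<open>open \<Omega>\<close> \<open>\<zeta> \<in> \<Omega>\<close> R]) auto
    also have "\<dots> \<le> (ln R - ln (R - t)) / (2 * pi)"
      using n elim by (intro divide_right_mono diff_left_mono ln_mono) auto
    also have "ln R - ln (R - t) = - ln (1 - t / R)"
    proof -
      have "1 - t / R = (R - t) / R" using \<open>0 < R\<close> by (simp add: field_simps)
      then show ?thesis using elim by (simp add: ln_div)
    qed
    finally show ?case using elim by (intro divide_right_mono) auto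
  qed
  then show ?thesis by (intro tendsto_le[OF _ 2 1]) auto
qed

text \<open>A point of the closure at maximal distance from \<zeta> has distance \<open>R\<close> by
  minimality of the disk. It is not in \<Omega>, because the enclosing ball is open.\<close>

lemma exists_farthest_frontier_point:
  assumes "open \<Omega>" "\<zeta> \<in> \<Omega>" "smallest_disk_containing \<Omega> \<zeta> R"
  obtains q where "q \<in> frontier \<Omega>" "norm (q - \<zeta>) = R"
proof -
  have R: "\<Omega> \<subseteq> ball \<zeta> R" and least: "\<And>r. \<Omega> \<subseteq> ball \<zeta> r \<Longrightarrow> R \<le> r"
    using assms(3) by (auto simp: smallest_disk_containing_def)
  have "bounded \<Omega>" using R bounded_subset bounded_ball by blast
  then have "compact (closure \<Omega>)" by (simp add: compact_closure)
  moreover have "closure \<Omega> \<noteq> {}" using assms by auto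
  moreover have "continuous_on (closure \<Omega>) (\<lambda>y. norm (y - \<zeta>))" by (intro continuous_intros)
  ultimately obtain q where q: "q \<in> closure \<Omega>" "\<And>y. y \<in> closure \<Omega> \<Longrightarrow> norm (y - \<zeta>) \<le> norm (q - \<zeta>)"
    using continuous_attains_sup[of "closure \<Omega>" "\<lambda>y. norm (y - \<zeta>)"] by blast
  have "closure \<Omega> \<subseteq> cball \<zeta> R" using R by (intro closure_minimal) auto
  then have "norm (q - \<zeta>) \<le> R" using q by (auto simp: dist_norm norm_minus_commute)
  moreover have "R \<le> norm (q - \<zeta>)"
  proof (rule dense_ge)
    fix r assume "norm (q - \<zeta>) < r"
    then have "\<Omega> \<subseteq> ball \<zeta> r"
      using q(2) closure_subset by (fastforce simp: dist_norm norm_minus_commute)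
    then show "R \<le> r" by (rule least)
  qed
  ultimately have "norm (q - \<zeta>) = R" by simp
  moreover have "q \<notin> \<Omega>" using R calculation by (auto simp: dist_norm norm_minus_commute)
  ultimately show thesis
    using q assms(1) by (intro that[of q]) (auto simp: frontier_def interior_open)
qed

section \<open>Hoelder norms and the final estimate\<close>

lemma abs_le_holder_norm:
  assumes "f \<in> holder_space \<alpha> I" "x \<in> I" "y \<in> I" "x \<noteq> y" "s \<in> I"
  shows "\<bar>f s\<bar> \<le> holder_norm \<alpha> I f"
proof -
  have bdd: "bdd_above ((\<lambda>x. \<bar>f x\<bar>) ` I)" "bdd_above (difference_quotients \<alpha> I f)"
    using assms(1) by (auto simp: holder_space_def)
  have "\<bar>f s\<bar> \<le> sup_norm_on I f"
    unfolding sup_norm_on_def using assms bdd by (intro cSUP_upper)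
  moreover have "0 \<le> holder_seminorm \<alpha> I f"
  proof -
    \<comment> \<open>The two distinct points show that the set of quotients is nonempty, so its
      real supremum dominates a nonnegative number.\<close>
    have "\<bar>f x - f y\<bar> / \<bar>x - y\<bar> powr \<alpha> \<in> difference_quotients \<alpha> I f"
      using assms by (auto simp: difference_quotients_def)
    then have "\<bar>f x - f y\<bar> / \<bar>x - y\<bar> powr \<alpha> \<le> holder_seminorm \<alpha> I f"
      unfolding holder_seminorm_def using bdd by (intro cSup_upper)
    moreover have "0 \<le> \<bar>f x - f y\<bar> / \<bar>x - y\<bar> powr \<alpha>" by simp
    ultimately show ?thesis by linarith
  qed
  ultimately show ?thesis by (simp add: holder_norm_def)
qed

lemma holder_space_diff_const:
  assumes "f \<in> holder_space \<alpha> J" "I \<subseteq> J"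
  shows "(\<lambda>x. f x - c) \<in> holder_space \<alpha> I"
proof -
  have bdd: "bdd_above ((\<lambda>x. \<bar>f x\<bar>) ` J)" "bdd_above (difference_quotients \<alpha> J f)"
    using assms(1) by (auto simp: holder_space_def)
  then obtain B where B: "\<And>x. x \<in> J \<Longrightarrow> \<bar>f x\<bar> \<le> B" by (auto simp: bdd_above_def)
  have "\<bar>f x - c\<bar> \<le> B + \<bar>c\<bar>" if "x \<in> I" for x using B[of x] assms(2) that by force
  then have "bdd_above ((\<lambda>x. \<bar>f x - c\<bar>) ` I)" by (intro bdd_aboveI) auto
  moreover have "difference_quotients \<alpha> I (\<lambda>x. f x - c) \<subseteq> difference_quotients \<alpha> J f"
    using assms(2) by (force simp: difference_quotients_def)
  ultimately show ?thesis using bdd by (auto simp: holder_space_def intro: bdd_above_mono)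
qed

theorem theorem1p1:
  fixes \<alpha> m M0 \<rho> :: real
  assumes "0 < \<alpha>" and "\<alpha> < 1" and "0 < m" and "0 < M0" and "0 < \<rho>"
  shows "\<exists>K::real. \<forall>(\<zeta>o::complex) (\<zeta>b::complex) (\<Omega>::complex set) (L::real) (R::real)
            (\<gamma>::real \<Rightarrow> complex) (u::complex \<Rightarrow> real) (\<phi>::real \<Rightarrow> real).
       \<zeta>o \<noteq> \<zeta>b \<and>
       open \<Omega> \<and> bounded \<Omega> \<and> simply_connected \<Omega> \<and> C1_alpha_boundary \<alpha> \<Omega> \<and>
       \<zeta>o \<in> \<Omega> \<and> \<zeta>b \<in> frontier \<Omega> \<and>
       boundary_arclength_param \<Omega> \<zeta>o L \<gamma> \<and> \<gamma> 0 = \<zeta>b \<and>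
       largest_disk_in \<Omega> \<zeta>o \<rho> \<and> smallest_disk_containing \<Omega> \<zeta>o R \<and>
       solves_dirichlet_delta \<Omega> \<zeta>o u \<and>
       interior_normal_derivative \<Omega> \<gamma> u \<phi> \<and>
       \<phi> \<in> G0 \<alpha> m M0 L
       \<longrightarrow> R - \<rho> \<le> K * holder_norm \<alpha> {0..L} (\<lambda>s. \<phi> s - 1 / (2 * pi * \<rho>))"
proof (intro exI[of _ "\<rho> / m"] allI impI, elim conjE)
  fix \<zeta>o \<zeta>b :: complex and \<Omega> L R \<gamma> u \<phi>
  assume \<Omega>: "open \<Omega>" "\<zeta>o \<in> \<Omega>" and \<gamma>: "boundary_arclength_param \<Omega> \<zeta>o L \<gamma>"
    and R: "smallest_disk_containing \<Omega> \<zeta>o R" and u: "solves_dirichlet_delta \<Omega> \<zeta>o u"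
    and \<phi>: "interior_normal_derivative \<Omega> \<gamma> u \<phi>" "\<phi> \<in> G0 \<alpha> m M0 L"
  have sub: "\<Omega> \<subseteq> ball \<zeta>o R" using R by (simp add: smallest_disk_containing_def)
  then have "0 < R" using \<Omega> by force
  obtain q where q: "q \<in> frontier \<Omega>" "norm (q - \<zeta>o) = R"
    using exists_farthest_frontier_point[OF \<Omega> R] .
  have "0 < L" "\<gamma> ` {0..<L} = frontier \<Omega>" using \<gamma> by (auto simp: boundary_arclength_param_def)
  with q(1) have "q \<in> \<gamma> ` {0..<L}" by simp
  then obtain s where s: "s \<in> {0..<L}" "\<gamma> s = q" by force
  have le: "\<phi> s \<le> 1 / (2 * pi * R)"
    using normal_derivative_le_at_farthest_point[OF u \<Omega> sub \<phi>(1)] q s by simp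
  have "m \<le> \<phi> s" and "\<phi> \<in> holder_space \<alpha> UNIV" using \<phi>(2) by (auto simp: G0_def)
  define N where "N = holder_norm \<alpha> {0..L} (\<lambda>s. \<phi> s - 1 / (2 * pi * \<rho>))"
  \<comment> \<open>The endpoints 0 and \<open>L\<close> serve as the two distinct points.\<close>
  have "\<bar>\<phi> s - 1 / (2 * pi * \<rho>)\<bar> \<le> N"
    unfolding N_def using \<open>0 < L\<close> s \<open>\<phi> \<in> holder_space \<alpha> UNIV\<close>
    by (intro abs_le_holder_norm[of "\<lambda>s. \<phi> s - 1 / (2 * pi * \<rho>)" _ _ 0 L] holder_space_diff_const[of \<phi> _ UNIV]) auto
  then have "1 / (2 * pi * \<rho>) - 1 / (2 * pi * R) \<le> N" and "0 \<le> N" using le by linarith+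
  \<comment> \<open>This multiplier turns the difference of reciprocals into
    \<open>R - \<rho>\<close>; the factor \<open>2 * pi * R\<close> it leaves on the right is then
    bounded by \<open>1 / m\<close>.\<close>
  from this(1) have "(1 / (2 * pi * \<rho>) - 1 / (2 * pi * R)) * (2 * pi * \<rho> * R) \<le> N * (2 * pi * \<rho> * R)"
    using assms \<open>0 < R\<close> by (intro mult_right_mono) auto
  also have "(1 / (2 * pi * \<rho>) - 1 / (2 * pi * R)) * (2 * pi * \<rho> * R) = R - \<rho>"
    using assms \<open>0 < R\<close> by (simp add: left_diff_distrib)
  also have "N * (2 * pi * \<rho> * R) = N * \<rho> * (2 * pi * R)" by simp
  also have "\<dots> \<le> N * \<rho> * (1 / m)"
  proof (intro mult_left_mono)
    have "m \<le> 1 / (2 * pi * R)" using \<open>m \<le> \<phi> s\<close> le by linarith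
    then show "2 * pi * R \<le> 1 / m" using assms \<open>0 < R\<close> by (simp add: field_simps)
  qed (use assms \<open>0 \<le> N\<close> in auto)
  finally show "R - \<rho> \<le> \<rho> / m * holder_norm \<alpha> {0..L} (\<lambda>s. \<phi> s - 1 / (2 * pi * \<rho>))"
    by (simp add: N_def mult.commute)
qed

end
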